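(* Let $0\le p\le1$, let $A\in\mathcal W_p(E)$ with representation $A=\sum_{j\in G}M_{b^{(j)}}V_j$, and let a finite truncation window $W\subset G$ be given. For $k\in G$ let $A_k:=AP_k$ and $(A^* )_k:=A^*P_k$, acting on $\ell^2(k+W,\cdot)$, and put $$\gamma_\varepsilon^W(A):=\Bigl\{\lambda\in\mathbb C:\inf_{k\in G}\min\{\nu(A_k-\lambda I_k),\nu((A^* )_k-\lambda I_k)\}<\varepsilon\Bigr\},\quad\varepsilon>0,$$ $$\Gamma_\varepsilon^W(A):=\Bigl\{\lambda\in\mathbb C:\inf_{k\in G}\min\{\nu(A_k-\lambda I_k),\nu((A^* )_k-\lambda I_k)\}\le\varepsilon\Bigr\},\quad\varepsilon\ge0.$$ (a) It holds that $$\gamma_\varepsilon^W(A)\subset\mathrm{spec}_\varepsilon A\subset\gamma^W_{\varepsilon+\varepsilon_p(W,A)}(A)\quad\text{for all }\varepsilon>0,$$ $$\Gamma_\varepsilon^W(A)\subset\mathrm{Spec}_\varepsilon A\subset\Gamma^W_{\varepsilon+\varepsilon_p(W,A)}(A)\quad\text{for all }\varepsilon\ge0,$$ where $$\varepsilon_p(W,A):=\sqrt{\sum_{j\in G\setminus\{0\}}\Bigl(\frac{\|b^{(j)}\|_\infty+\|b^{(-j)}\|_\infty}{2}\Bigr)^{2-p}}\ \sqrt{\min\operatorname{Spec}L_W^{(D)}}.$$ (b) If $\dim Y<\infty$, then $$\gamma_\varepsilon^W(A)=\bigcup_{k\in G}\bigl(\mathrm{spec}_\varepsilon A_k\cup\mathrm{spec}_\varepsilon(A^*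 )_k\bigr),\qquad\varepsilon>0,$$ where the pseudospectra of the patches are understood in the sense for non-square operators, i.e. $\mathrm{spec}_\varepsilon B_k:=\{\lambda\in\mathbb C:\nu(B_k-\lambda I_k)<\varepsilon\}$ for $\varepsilon>0$ and $\mathrm{Spec}_\varepsilon B_k:=\{\lambda\in\mathbb C:\nu(B_k-\lambda I_k)\le\varepsilon\}$ for $\varepsilon\ge0$, with $B_k\in\{A_k,(A^* )_k\}$; whereas $\Gamma_\varepsilon^W(A)$ is in general neither $\bigcup_{k\in G}\bigl(\mathrm{Spec}_\varepsilon A_k\cup\mathrm{Spec}_\varepsilon(A^* )_k\bigr)$ nor its closure.
   Context: $(G,+)$ is a countable Abelian group with counting measure, $Y$ is a Hilbert space, $E:=\ell^2(G,Y)$. $M_b$ is multiplication by $b\in\ell^\infty(G,L(Y))$, $(M_bx)_i=b_ix_i$; $V_j$ is the shift $(V_jx)_i=x_{i-j}$. The Wiener algebra $\mathcal W(E)$ is the set of all $A=\sum_{j\in G}M_{b^{(j)}}V_j$ with $b^{(j)}\in\ell^\infty(G,L(Y))$ and $\sum_{j\in G}\|b^{(j)}\|_\infty<\infty$. For $0\le p\le1$, $\mathcal W_p(E):=\{A\in\mathcal W(E):w_p(A):=\sum_{j\in G}\|b^{(j)}\|_\infty^p<\infty\}$. Convention: $a^0:=\lim_{p\to0^+}a^p$ for $a\ge0$, so $0^0=0$. $A^*$ is the Banach space adjoint (transpose without conjugation), acting on $\ell^2(G,Y')$ with $Y'$ the dual of $Y$; in particular $(\lambda I)^*=\lambda I$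 for $\lambda\in\mathbb C$. $P_k$ is multiplication by the characteristic function of $k+W$ (on $\ell^2(G,Y)$ resp. $\ell^2(G,Y')$); its range is identified with $\ell^2(k+W,\cdot)$. $A_k$ and $(A^* )_k$ map $\ell^2(k+W,\cdot)$ into $\ell^2(G,\cdot)$, and $I_k$ is the canonical embedding (extension by zero) of $\ell^2(k+W,\cdot)$ into $\ell^2(G,\cdot)$. The lower norm of a bounded linear operator $B$ is $\nu(B):=\inf\{\|Bx\|:\|x\|=1\}$. For $B$ bounded on $E$, $\mu(B):=\min(\nu(B),\nu(B^* ))$ (which equals $\|B^{-1}\|^{-1}$, read as $0$ if $B$ is not invertible), $\mathrm{spec}_\varepsilon A:=\{\lambda\in\mathbb C:\mu(A-\lambda I)<\varepsilon\}$ for $\varepsilon>0$, and $\mathrm{Spec}_\varepsilon A:=\{\lambda\in\mathbb C:\mu(A-\lambda I)\le\varepsilon\}$ for $\varepsilon\ge0$; so $\mathrm{Spec}_0A$ is the spectrum of $A$. Put $b(k,\ell):=2\bigl(\frac{\|b^{(k-\ell)}\|_\infty+\|b^{(\ell-k)}\|_\infty}{2}\bigr)^p$ for $k\ne\ell$ and $b(k,k):=0$ ($k,\ell\in G$). $L_W^{(D)}$ is the Dirichlet Laplacian with respect to $W$ for the graph over $G$ with edge weights $b$ and zero potential, i.e. the non-negative self-adjoint operator on $\ell^2(W)$ $$(L_W^{(D)}x)_k=\sum_{\ell\in W}b(k,\ell)(x_k-x_\ell)+\Bigl(\sum_{\ell\in G\setminus W}b(k,\ell)\Bigr)x_k\qquad(k\in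 W).$$ *)

theory Defs
  imports "HOL-Analysis.Analysis"
begin

section \<open>Complex normed spaces and Hilbert spaces\<close>

class complex_normed_space = real_normed_vector +
  fixes scaleC :: "complex \<Rightarrow> 'a \<Rightarrow> 'a" (infixr "*\<^sub>C" 75)
  assumes scaleC_add_right: "a *\<^sub>C (x + y) = a *\<^sub>C x + a *\<^sub>C y"
    and scaleC_add_left: "(a + b) *\<^sub>C x = a *\<^sub>C x + b *\<^sub>C x"
    and scaleC_scaleC: "a *\<^sub>C b *\<^sub>C x = (a * b) *\<^sub>C x"
    and scaleC_one: "1 *\<^sub>C x = x"
    and scaleR_scaleC: "r *\<^sub>R x = complex_of_real r *\<^sub>C x"
    and norm_scaleC: "norm (a *\<^sub>C x) = cmod a * norm x"

class chilbert_space = complex_normed_space + complete_space +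
  fixes cinner :: "'a \<Rightarrow> 'a \<Rightarrow> complex"
  assumes cinner_commute: "cinner x y = cnj (cinner y x)"
    and cinner_add_left: "cinner (x + y) z = cinner x z + cinner y z"
    and cinner_scaleC_left: "cinner (a *\<^sub>C x) y = a * cinner x y"
    and norm_eq_cinner: "complex_of_real ((norm x)\<^sup>2) = cinner x x"

lemma vector_space_scaleC:
  "vector_space (scaleC :: complex \<Rightarrow> 'a::complex_normed_space \<Rightarrow> 'a)"
  by standard (simp_all add: scaleC_add_right scaleC_add_left scaleC_scaleC scaleC_one)

definition cspan :: "'a::complex_normed_space set \<Rightarrow> 'a set" where
  "cspan = module.span scaleC"

instantiation complex :: chilbert_space
begin

definition scaleC_complex :: "complex \<Rightarrow> complex \<Rightarrow> complex" where
  "scaleC_complex a x = a * x"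

definition cinner_complex :: "complex \<Rightarrow> complex \<Rightarrow> complex" where
  "cinner_complex x y = x * cnj y"

instance
proof
  fix x y z a b :: complex and r :: real
  show "complex_of_real ((norm x)\<^sup>2) = cinner x x"
    by (simp only: cinner_complex_def complex_norm_square)
qed (simp_all add: scaleC_complex_def cinner_complex_def distrib_left distrib_right
    scaleR_conv_of_real norm_mult)

end

section \<open>Bounded complex-linear operators\<close>

definition bounded_clinear ::
  "('a::complex_normed_space \<Rightarrow> 'b::complex_normed_space) \<Rightarrow> bool" where
  "bounded_clinear f \<longleftrightarrow> bounded_linear f \<and> (\<forall>c x. f (c *\<^sub>C x) = c *\<^sub>C f x)"

lemma bounded_clinearI:
  fixes f :: "'a::complex_normed_space \<Rightarrow> 'b::complex_normed_space"
  assumes "\<And>x y. f (x + y) = f x + f y" "\<And>c x. f (c *\<^sub>C x) = c *\<^sub>C f x"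
    and "\<And>x. norm (f x) \<le> K * norm x"
  shows "bounded_clinear f"
  unfolding bounded_clinear_def
proof (intro conjI allI assms(2))
  show "bounded_linear f"
    by (rule bounded_linear_intro[where K = K])
      (auto simp: assms scaleR_scaleC mult.commute)
qed

typedef (overloaded) ('a, 'b) cblinfun =
  "{f :: 'a::complex_normed_space \<Rightarrow> 'b::complex_normed_space. bounded_clinear f}"
  morphisms cblinfun_apply Abs_cblinfun
proof -
  have "bounded_clinear (\<lambda>x::'a. 0::'b)"
    by (rule bounded_clinearI[where K = 0]) (auto, metis scaleC_add_right add_cancel_right_right)
  then show ?thesis by blast
qed

setup_lifting type_definition_cblinfun

lemma scaleC_zero_right [simp]: "c *\<^sub>C (0::'a::complex_normed_space) = 0"
  by (metis scaleC_add_right add_cancel_right_right)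

lemma scaleC_minus_right: "c *\<^sub>C (- x) = - (c *\<^sub>C (x::'a::complex_normed_space))"
  by (metis scaleC_add_right scaleC_zero_right add.right_inverse minus_unique)

instantiation cblinfun :: (complex_normed_space, complex_normed_space) complex_normed_space
begin

lift_definition norm_cblinfun :: "('a, 'b) cblinfun \<Rightarrow> real" is onorm .

lift_definition minus_cblinfun :: "('a, 'b) cblinfun \<Rightarrow> ('a, 'b) cblinfun \<Rightarrow> ('a, 'b) cblinfun"
  is "\<lambda>f g x. f x - g x"
  unfolding bounded_clinear_def
  by (auto intro: bounded_linear_sub)
    (metis diff_conv_add_uminus scaleC_add_right scaleC_minus_right)

lift_definition uminus_cblinfun :: "('a, 'b) cblinfun \<Rightarrow> ('a, 'b) cblinfun" is "\<lambda>f x. - f x"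
  unfolding bounded_clinear_def by (auto intro: bounded_linear_minus simp: scaleC_minus_right)

lift_definition zero_cblinfun :: "('a, 'b) cblinfun" is "\<lambda>x. 0"
  by (simp add: bounded_clinear_def bounded_linear_zero)

lift_definition plus_cblinfun :: "('a, 'b) cblinfun \<Rightarrow> ('a, 'b) cblinfun \<Rightarrow> ('a, 'b) cblinfun"
  is "\<lambda>f g x. f x + g x"
  unfolding bounded_clinear_def by (auto intro: bounded_linear_add simp: scaleC_add_right)

lift_definition scaleR_cblinfun :: "real \<Rightarrow> ('a, 'b) cblinfun \<Rightarrow> ('a, 'b) cblinfun"
  is "\<lambda>r f x. r *\<^sub>R f x"
  unfolding bounded_clinear_def
  by (auto intro: bounded_linear_compose[OF bounded_linear_scaleR_right])
    (simp add: scaleR_scaleC scaleC_scaleC mult.commute)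

lift_definition scaleC_cblinfun :: "complex \<Rightarrow> ('a, 'b) cblinfun \<Rightarrow> ('a, 'b) cblinfun"
  is "\<lambda>c f x. c *\<^sub>C f x"
proof -
  fix c and f :: "'a \<Rightarrow> 'b" assume f: "bounded_clinear f"
  show "bounded_clinear (\<lambda>x. c *\<^sub>C f x)"
  proof (rule bounded_clinearI)
    fix x show "norm (c *\<^sub>C f x) \<le> (cmod c * onorm f) * norm x"
      using f onorm[of f x] by (simp add: bounded_clinear_def norm_scaleC mult.assoc mult_left_mono)
  qed (use f in \<open>auto simp: bounded_clinear_def scaleC_add_right scaleC_scaleC mult.commute
      bounded_linear.linear linear_add\<close>)
qed

definition dist_cblinfun :: "('a, 'b) cblinfun \<Rightarrow> ('a, 'b) cblinfun \<Rightarrow> real" where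
  "dist_cblinfun a b = norm (a - b)"

definition uniformity_cblinfun :: "(('a, 'b) cblinfun \<times> ('a, 'b) cblinfun) filter" where
  "uniformity_cblinfun = (INF e\<in>{0 <..}. principal {(x, y). dist x y < e})"

definition open_cblinfun :: "('a, 'b) cblinfun set \<Rightarrow> bool" where
  "open_cblinfun S = (\<forall>x\<in>S. \<forall>\<^sub>F (x', y) in uniformity. x' = x \<longrightarrow> y \<in> S)"

definition sgn_cblinfun :: "('a, 'b) cblinfun \<Rightarrow> ('a, 'b) cblinfun" where
  "sgn_cblinfun x = inverse (norm x) *\<^sub>R x"

instance
proof
  fix f g h :: "('a, 'b) cblinfun" and r s :: real and a b :: complex
  show "f + g + h = f + (g + h)" "f + g = g + f" "0 + f = f" "- f + f = 0" "f - g = f + - g"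
    "r *\<^sub>R (f + g) = r *\<^sub>R f + r *\<^sub>R g" "(r + s) *\<^sub>R f = r *\<^sub>R f + s *\<^sub>R f"
    "r *\<^sub>R s *\<^sub>R f = (r * s) *\<^sub>R f" "1 *\<^sub>R f = f"
    "a *\<^sub>C (f + g) = a *\<^sub>C f + a *\<^sub>C g" "(a + b) *\<^sub>C f = a *\<^sub>C f + b *\<^sub>C f"
    "a *\<^sub>C b *\<^sub>C f = (a * b) *\<^sub>C f" "1 *\<^sub>C f = f" "r *\<^sub>R f = complex_of_real r *\<^sub>C f"
    by (transfer, force simp: algebra_simps scaleC_add_right scaleC_add_left scaleC_scaleC scaleC_one
        scaleR_scaleC)+
  show "norm f = 0 \<longleftrightarrow> f = 0" "norm (f + g) \<le> norm f + norm g" "norm (r *\<^sub>R f) = \<bar>r\<bar> * norm f"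
    by (transfer, force simp: bounded_clinear_def onorm_triangle onorm_scaleR onorm_eq_0)+
  show "norm (a *\<^sub>C f) = cmod a * norm f"
  proof (transfer fixing: a)
    fix f :: "'a \<Rightarrow> 'b" assume "bounded_clinear f"
    then have f: "bounded_linear f" by (simp add: bounded_clinear_def)
    have "onorm (\<lambda>x. a *\<^sub>C f x) = onorm (\<lambda>x. cmod a *\<^sub>R f x)"
      by (simp add: onorm_def norm_scaleC)
    then show "onorm (\<lambda>x. a *\<^sub>C f x) = cmod a * onorm f"
      using onorm_scaleR[OF f, of "cmod a"] by simp
  qed
qed (simp_all add: dist_cblinfun_def open_cblinfun_def sgn_cblinfun_def uniformity_cblinfun_def)

end

lemma cblinfun_apply_bounded_clinear: "bounded_clinear (cblinfun_apply f)"
  using cblinfun_apply by blast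

lemma norm_cblinfun: "norm (cblinfun_apply f x) \<le> norm f * norm x"
  by transfer (simp add: bounded_clinear_def onorm)

lemma norm_cblinfun_bound:
  "0 \<le> b \<Longrightarrow> (\<And>x. norm (cblinfun_apply f x) \<le> b * norm x) \<Longrightarrow> norm f \<le> b"
  by transfer (rule onorm_bound)

lemma cblinfun_apply_add: "cblinfun_apply f (x + y) = cblinfun_apply f x + cblinfun_apply f y"
  using cblinfun_apply_bounded_clinear[of f]
  by (simp add: bounded_clinear_def bounded_linear.linear linear_add)

lemma cblinfun_apply_scaleC: "cblinfun_apply f (c *\<^sub>C x) = c *\<^sub>C cblinfun_apply f x"
  using cblinfun_apply_bounded_clinear[of f] by (simp add: bounded_clinear_def)

lift_definition cblinfun_id :: "('a::complex_normed_space, 'a) cblinfun" is "\<lambda>x. x"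
  by (simp add: bounded_clinear_def bounded_linear_ident)

lift_definition cblinfun_compose ::
  "('b::complex_normed_space, 'c::complex_normed_space) cblinfun \<Rightarrow>
   ('a::complex_normed_space, 'b) cblinfun \<Rightarrow> ('a, 'c) cblinfun" (infixl "o\<^sub>C" 67)
  is "\<lambda>f g x. f (g x)"
  by (auto simp: bounded_clinear_def intro: bounded_linear_compose)

section \<open>The sequence space\<close>

typedef (overloaded) ('g, 'y) ell2 =
  "{x :: 'g \<Rightarrow> 'y::complex_normed_space. (\<lambda>i. (norm (x i))\<^sup>2) summable_on UNIV}"
  morphisms ell2_nth Abs_ell2
  by (rule exI[of _ "\<lambda>_. 0"]) simp

setup_lifting type_definition_ell2

lemma ell2_L2_set_le:
  assumes "(\<lambda>i. (norm (f i))\<^sup>2) summable_on UNIV" "finite F"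
  shows "L2_set (\<lambda>i. norm (f i)) F \<le> sqrt (\<Sum>\<^sub>\<infinity>i. (norm (f i))\<^sup>2)"
  unfolding L2_set_def
  by (rule real_sqrt_le_mono, rule finite_sum_le_infsum) (use assms in auto)

lemma ell2_boundI:
  assumes "\<And>F. finite F \<Longrightarrow> L2_set (\<lambda>i. norm (f i)) F \<le> C"
  shows "(\<lambda>i. (norm (f i))\<^sup>2) summable_on UNIV" "sqrt (\<Sum>\<^sub>\<infinity>i. (norm (f i))\<^sup>2) \<le> C"
proof -
  have C: "0 \<le> C" using assms[of "{}"] by simp
  have *: "(\<Sum>i\<in>F. (norm (f i))\<^sup>2) \<le> C\<^sup>2" if "finite F" for F
    using assms[OF that] unfolding L2_set_def
    by (metis C real_sqrt_abs real_sqrt_le_iff abs_of_nonneg)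
  show s: "(\<lambda>i. (norm (f i))\<^sup>2) summable_on UNIV"
    by (rule nonneg_bdd_above_summable_on) (auto intro!: bdd_aboveI[of _ "C\<^sup>2"] *)
  have "(\<Sum>\<^sub>\<infinity>i. (norm (f i))\<^sup>2) \<le> C\<^sup>2"
    by (rule infsum_le_finite_sums[OF s]) (use * in auto)
  then show "sqrt (\<Sum>\<^sub>\<infinity>i. (norm (f i))\<^sup>2) \<le> C"
    by (metis C real_sqrt_abs real_sqrt_le_iff abs_of_nonneg)
qed

lemma ell2_triangle:
  assumes "(\<lambda>i. (norm (f i))\<^sup>2) summable_on UNIV" "(\<lambda>i. (norm (g i))\<^sup>2) summable_on UNIV"
  shows "(\<lambda>i. (norm (f i + g i))\<^sup>2) summable_on UNIV"
    and "sqrt (\<Sum>\<^sub>\<infinity>i. (norm (f i + g i))\<^sup>2)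
      \<le> sqrt (\<Sum>\<^sub>\<infinity>i. (norm (f i))\<^sup>2) + sqrt (\<Sum>\<^sub>\<infinity>i. (norm (g i))\<^sup>2)"
proof -
  have *: "L2_set (\<lambda>i. norm (f i + g i)) F
      \<le> sqrt (\<Sum>\<^sub>\<infinity>i. (norm (f i))\<^sup>2) + sqrt (\<Sum>\<^sub>\<infinity>i. (norm (g i))\<^sup>2)" if "finite F" for F
  proof -
    have "L2_set (\<lambda>i. norm (f i + g i)) F \<le> L2_set (\<lambda>i. norm (f i) + norm (g i)) F"
      by (rule L2_set_mono) (auto simp: norm_triangle_ineq)
    also have "\<dots> \<le> L2_set (\<lambda>i. norm (f i)) F + L2_set (\<lambda>i. norm (g i)) F"
      by (rule L2_set_triangle_ineq)
    also have "\<dots> \<le> sqrt (\<Sum>\<^sub>\<infinity>i. (norm (f i))\<^sup>2) + sqrt (\<Sum>\<^sub>\<infinity>i. (norm (g i))\<^sup>2)"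
      by (intro add_mono ell2_L2_set_le assms that)
    finally show ?thesis .
  qed
  show "(\<lambda>i. (norm (f i + g i))\<^sup>2) summable_on UNIV"
    and "sqrt (\<Sum>\<^sub>\<infinity>i. (norm (f i + g i))\<^sup>2)
      \<le> sqrt (\<Sum>\<^sub>\<infinity>i. (norm (f i))\<^sup>2) + sqrt (\<Sum>\<^sub>\<infinity>i. (norm (g i))\<^sup>2)"
    by (rule ell2_boundI[OF *], assumption)+
qed

lemma ell2_summable_minus:
  assumes "(\<lambda>i. (norm (f i))\<^sup>2) summable_on UNIV" "(\<lambda>i. (norm (g i))\<^sup>2) summable_on UNIV"
  shows "(\<lambda>i. (norm (f i - g i))\<^sup>2) summable_on UNIV"
  using ell2_triangle(1)[of f "\<lambda>i. - g i"] assms by simp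

instantiation ell2 :: (type, complex_normed_space) complex_normed_space
begin

lift_definition norm_ell2 :: "('a, 'b) ell2 \<Rightarrow> real" is "\<lambda>x. sqrt (\<Sum>\<^sub>\<infinity>i. (norm (x i))\<^sup>2)" .

lift_definition minus_ell2 :: "('a, 'b) ell2 \<Rightarrow> ('a, 'b) ell2 \<Rightarrow> ('a, 'b) ell2"
  is "\<lambda>x y i. x i - y i" by (rule ell2_summable_minus)

lift_definition uminus_ell2 :: "('a, 'b) ell2 \<Rightarrow> ('a, 'b) ell2" is "\<lambda>x i. - x i" by simp

lift_definition zero_ell2 :: "('a, 'b) ell2" is "\<lambda>i. 0" by simp

lift_definition plus_ell2 :: "('a, 'b) ell2 \<Rightarrow> ('a, 'b) ell2 \<Rightarrow> ('a, 'b) ell2"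
  is "\<lambda>x y i. x i + y i" by (rule ell2_triangle(1))

lift_definition scaleR_ell2 :: "real \<Rightarrow> ('a, 'b) ell2 \<Rightarrow> ('a, 'b) ell2" is "\<lambda>r x i. r *\<^sub>R x i"
  by (simp add: power_mult_distrib summable_on_cmult_right)

lift_definition scaleC_ell2 :: "complex \<Rightarrow> ('a, 'b) ell2 \<Rightarrow> ('a, 'b) ell2" is "\<lambda>c x i. c *\<^sub>C x i"
  by (simp add: power_mult_distrib norm_scaleC summable_on_cmult_right)

definition dist_ell2 :: "('a, 'b) ell2 \<Rightarrow> ('a, 'b) ell2 \<Rightarrow> real" where
  "dist_ell2 a b = norm (a - b)"

definition uniformity_ell2 :: "(('a, 'b) ell2 \<times> ('a, 'b) ell2) filter" where
  "uniformity_ell2 = (INF e\<in>{0 <..}. principal {(x, y). dist x y < e})"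

definition open_ell2 :: "('a, 'b) ell2 set \<Rightarrow> bool" where
  "open_ell2 S = (\<forall>x\<in>S. \<forall>\<^sub>F (x', y) in uniformity. x' = x \<longrightarrow> y \<in> S)"

definition sgn_ell2 :: "('a, 'b) ell2 \<Rightarrow> ('a, 'b) ell2" where
  "sgn_ell2 x = inverse (norm x) *\<^sub>R x"

instance
proof
  fix x y z :: "('a, 'b) ell2" and r s :: real and a b :: complex
  show "x + y + z = x + (y + z)" "x + y = y + x" "0 + x = x" "- x + x = 0" "x - y = x + - y"
    "r *\<^sub>R (x + y) = r *\<^sub>R x + r *\<^sub>R y" "(r + s) *\<^sub>R x = r *\<^sub>R x + s *\<^sub>R x"
    "r *\<^sub>R s *\<^sub>R x = (r * s) *\<^sub>R x" "1 *\<^sub>R x = x"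
    "a *\<^sub>C (x + y) = a *\<^sub>C x + a *\<^sub>C y" "(a + b) *\<^sub>C x = a *\<^sub>C x + b *\<^sub>C x"
    "a *\<^sub>C b *\<^sub>C x = (a * b) *\<^sub>C x" "1 *\<^sub>C x = x" "r *\<^sub>R x = complex_of_real r *\<^sub>C x"
    by (transfer, force simp: algebra_simps scaleC_add_right scaleC_add_left scaleC_scaleC scaleC_one
        scaleR_scaleC)+
  show "norm (x + y) \<le> norm x + norm y"
    by transfer (rule ell2_triangle(2))
  show "norm x = 0 \<longleftrightarrow> x = 0"
  proof (transfer, safe)
    fix f :: "'a \<Rightarrow> 'b"
    assume f: "(\<lambda>i. (norm (f i))\<^sup>2) summable_on UNIV" "sqrt (\<Sum>\<^sub>\<infinity>i. (norm (f i))\<^sup>2) = 0"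
    have "f i = 0" for i
      using ell2_L2_set_le[OF f(1), of "{i}"] f(2) by (simp add: L2_set_def)
    then show "f = (\<lambda>i. 0)" by blast
  qed simp
  show "norm (r *\<^sub>R x) = \<bar>r\<bar> * norm x"
    by transfer (simp add: power_mult_distrib infsum_cmult_right' real_sqrt_mult)
  show "norm (a *\<^sub>C x) = cmod a * norm x"
    by transfer (simp add: norm_scaleC power_mult_distrib infsum_cmult_right' real_sqrt_mult)
qed (simp_all add: dist_ell2_def open_ell2_def sgn_ell2_def uniformity_ell2_def)

end

lemma norm_ell2_nth_le: "norm (ell2_nth x i) \<le> norm x"
  by transfer (use ell2_L2_set_le[of _ "{_}"] in \<open>simp add: L2_set_def\<close>)

lemma ell2_nth_summable: "(\<lambda>i. (norm (ell2_nth x i))\<^sup>2) summable_on UNIV"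
  using ell2_nth by blast

lemma ell2_L2_set_le_norm: "finite F \<Longrightarrow> L2_set (\<lambda>i. norm (ell2_nth x i)) F \<le> norm x"
  unfolding norm_ell2.rep_eq by (rule ell2_L2_set_le[OF ell2_nth_summable])

lemma norm_ell2_boundI:
  "(\<And>F. finite F \<Longrightarrow> L2_set (\<lambda>i. norm (ell2_nth x i)) F \<le> C) \<Longrightarrow> norm x \<le> C"
  unfolding norm_ell2.rep_eq by (rule ell2_boundI(2))

lemma coordinatewise_operator:
  fixes t :: "('g, 'y::complex_normed_space) ell2 \<Rightarrow> 'h \<Rightarrow> 'z::complex_normed_space"
  assumes add: "\<And>x y i. t (x + y) i = t x i + t y i"
    and scale: "\<And>c x i. t (c *\<^sub>C x) i = c *\<^sub>C t x i"
    and bound: "\<And>x F. finite F \<Longrightarrow> L2_set (\<lambda>i. norm (t x i)) F \<le> K * norm x"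
  shows "ell2_nth (cblinfun_apply (Abs_cblinfun (\<lambda>x. Abs_ell2 (t x))) x) = t x"
proof -
  have nth: "ell2_nth (Abs_ell2 (t x)) = t x" for x
    using ell2_boundI(1)[OF bound, of x] by (intro Abs_ell2_inverse) auto
  have "bounded_clinear (\<lambda>x. Abs_ell2 (t x))"
  proof (rule bounded_clinearI)
    show "norm (Abs_ell2 (t x)) \<le> K * norm x" for x
      by (rule norm_ell2_boundI) (simp add: nth bound)
  qed (simp_all add: ell2_nth_inject[symmetric] plus_ell2.rep_eq scaleC_ell2.rep_eq nth fun_eq_iff add scale)
  then show ?thesis by (simp add: Abs_cblinfun_inverse nth)
qed

text \<open>The closed subspace of the sequences supported in \<open>S\<close>, identified with the
  sequence space over \<open>S\<close>.\<close>

definition ell2_on :: "'g set \<Rightarrow> ('g, 'y::complex_normed_space) ell2 set" where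
  "ell2_on S = {x. \<forall>i. i \<notin> S \<longrightarrow> ell2_nth x i = 0}"

definition shift_op ::
  "'g::ab_group_add \<Rightarrow> (('g, 'y::complex_normed_space) ell2, ('g, 'y) ell2) cblinfun" where
  "shift_op j = Abs_cblinfun (\<lambda>x. Abs_ell2 (\<lambda>i. ell2_nth x (i - j)))"

lemma shift_op_nth:
  fixes x :: "('g::ab_group_add, 'y::complex_normed_space) ell2"
  shows "ell2_nth (cblinfun_apply (shift_op j) x) i = ell2_nth x (i - j)"
proof -
  have "L2_set (\<lambda>i. norm (ell2_nth x (i - j))) F \<le> 1 * norm x" if "finite F"
    for x :: "('g, 'y) ell2" and F
  proof -
    have "L2_set (\<lambda>i. norm (ell2_nth x (i - j))) F
        = L2_set (\<lambda>i. norm (ell2_nth x i)) ((\<lambda>i. i - j) ` F)"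
      unfolding L2_set_def by (subst sum.reindex) (auto simp: inj_on_def)
    then show ?thesis using ell2_L2_set_le_norm[of "(\<lambda>i. i - j) ` F" x] that by simp
  qed
  then show ?thesis
    unfolding shift_op_def
    by (subst coordinatewise_operator[where K = 1]) (auto simp: plus_ell2.rep_eq scaleC_ell2.rep_eq)
qed

text \<open>Only meaningful when \<open>c\<close> is bounded; see the lemma below.\<close>

definition mult_op ::
  "('g \<Rightarrow> ('y::complex_normed_space, 'y) cblinfun) \<Rightarrow> (('g, 'y) ell2, ('g, 'y) ell2) cblinfun" where
  "mult_op c = Abs_cblinfun (\<lambda>x. Abs_ell2 (\<lambda>i. cblinfun_apply (c i) (ell2_nth x i)))"

lemma mult_op_nth:
  assumes "bounded (range c)"
  shows "ell2_nth (cblinfun_apply (mult_op c) x) i = cblinfun_apply (c i) (ell2_nth x i)"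
proof -
  obtain K where K: "norm (c i) \<le> K" for i
    using assms by (auto simp: bounded_iff)
  then have K0: "0 \<le> K" using norm_ge_zero order_trans by blast
  have "L2_set (\<lambda>i. norm (cblinfun_apply (c i) (ell2_nth x i))) F \<le> K * norm x" if "finite F" for x F
  proof -
    have "L2_set (\<lambda>i. norm (cblinfun_apply (c i) (ell2_nth x i))) F
        \<le> L2_set (\<lambda>i. K * norm (ell2_nth x i)) F"
      by (rule L2_set_mono) (auto intro!: order_trans[OF norm_cblinfun] mult_right_mono K)
    also have "\<dots> = K * L2_set (\<lambda>i. norm (ell2_nth x i)) F"
      using K0 by (simp add: L2_set_right_distrib)
    also have "\<dots> \<le> K * norm x"
      by (intro mult_left_mono ell2_L2_set_le_norm that K0)
    finally show ?thesis .
  qed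
  then show ?thesis
    unfolding mult_op_def
    by (subst coordinatewise_operator[where K = K])
      (auto simp: plus_ell2.rep_eq scaleC_ell2.rep_eq cblinfun_apply_add cblinfun_apply_scaleC)
qed

definition cutoff_op :: "'g set \<Rightarrow> (('g, 'y::complex_normed_space) ell2, ('g, 'y) ell2) cblinfun" where
  "cutoff_op S = mult_op (\<lambda>i. if i \<in> S then cblinfun_id else 0)"

lemma cutoff_op_nth:
  fixes x :: "('g, 'y::complex_normed_space) ell2"
  shows "ell2_nth (cblinfun_apply (cutoff_op S) x) i = (if i \<in> S then ell2_nth x i else 0)"
proof -
  have "finite (range (\<lambda>i. if i \<in> S then cblinfun_id else (0::('y, 'y) cblinfun)))"
    by (rule finite_subset[of _ "{cblinfun_id, 0}"]) auto
  then show ?thesis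
    unfolding cutoff_op_def
    by (subst mult_op_nth) (auto simp: finite_imp_bounded cblinfun_id.rep_eq zero_cblinfun.rep_eq)
qed

section \<open>The adjoint\<close>

type_synonym 'y dual = "('y, complex) cblinfun"

text \<open>The bilinear pairing through which the sequence space over the dual of \<open>'y\<close> is the dual
  of the sequence space over \<open>'y\<close>.\<close>

definition pairing ::
  "('g, 'y::complex_normed_space dual) ell2 \<Rightarrow> ('g, 'y) ell2 \<Rightarrow> complex" where
  "pairing f x = (\<Sum>\<^sub>\<infinity>i. cblinfun_apply (ell2_nth f i) (ell2_nth x i))"

definition adj_op ::
  "(('g, 'y::complex_normed_space) ell2, ('g, 'y) ell2) cblinfun \<Rightarrow>
   (('g, 'y dual) ell2, ('g, 'y dual) ell2) cblinfun" where
  "adj_op A = (THE B. \<forall>f x. pairing (cblinfun_apply B f) x = pairing f (cblinfun_apply A x))"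

lift_definition ell2_single :: "'g \<Rightarrow> 'y \<Rightarrow> ('g, 'y::complex_normed_space) ell2"
  is "\<lambda>i y k. if k = i then y else 0"
proof -
  fix i :: 'g and y :: 'y
  show "(\<lambda>k. (norm (if k = i then y else 0))\<^sup>2) summable_on UNIV"
    by (subst summable_on_cong_neutral[where T = "{i}"]) auto
qed

lemma ell2_nth_sum: "ell2_nth (sum h F) k = (\<Sum>i\<in>F. ell2_nth (h i) k)"
  by (induction F rule: infinite_finite_induct) (auto simp: zero_ell2.rep_eq plus_ell2.rep_eq)

lemma ell2_nth_sum_single:
  "finite F \<Longrightarrow> ell2_nth (\<Sum>i\<in>F. ell2_single i (y i)) k = (if k \<in> F then y k else 0)"
  by (simp add: ell2_nth_sum ell2_single.rep_eq)

lemma has_sum_ell2_single: "((\<lambda>i. ell2_single i (ell2_nth x i)) has_sum x) UNIV"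
  unfolding has_sum_def
proof (rule tendstoI)
  fix e :: real assume e: "0 < e"
  let ?a = "\<lambda>i. (norm (ell2_nth x i))\<^sup>2" and ?S = "(\<Sum>\<^sub>\<infinity>i. (norm (ell2_nth x i))\<^sup>2)"
  have s: "?a summable_on UNIV" by (rule ell2_nth_summable)
  have "((\<lambda>F. sum ?a F) \<longlongrightarrow> ?S) (finite_subsets_at_top UNIV)"
    by (rule infsum_tendsto[OF s])
  then have "\<forall>\<^sub>F F in finite_subsets_at_top UNIV. dist (sum ?a F) ?S < (e/2)\<^sup>2"
    using e by (intro tendstoD) auto
  moreover have "\<forall>\<^sub>F F in finite_subsets_at_top UNIV. finite (F :: 'a set)"
    by (simp add: eventually_finite_subsets_at_top_weakI)
  ultimately show "\<forall>\<^sub>F F in finite_subsets_at_top UNIV.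
      dist (\<Sum>i\<in>F. ell2_single i (ell2_nth x i)) x < e"
  proof eventually_elim
    case (elim F)
    have "norm (x - (\<Sum>i\<in>F. ell2_single i (ell2_nth x i))) \<le> e/2"
    proof (rule norm_ell2_boundI)
      fix H :: "'a set" assume H: "finite H"
      have "(\<Sum>i\<in>H. (norm (ell2_nth (x - (\<Sum>i\<in>F. ell2_single i (ell2_nth x i))) i))\<^sup>2)
          = (\<Sum>i\<in>H. if i \<in> F then 0 else ?a i)"
        by (intro sum.cong refl) (auto simp: minus_ell2.rep_eq ell2_nth_sum_single elim)
      also have "\<dots> = sum ?a (H - F)"
        using H by (intro sum.mono_neutral_cong_right) auto
      also have "\<dots> = sum ?a (F \<union> H) - sum ?a F"
        using H elim by (subst Un_Diff_cancel[symmetric], subst sum.union_disjoint) auto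
      also have "\<dots> \<le> ?S - sum ?a F"
        using H elim by (intro diff_right_mono finite_sum_le_infsum s) auto
      also have "\<dots> \<le> (e/2)\<^sup>2"
        using elim by (simp add: dist_real_def)
      finally show "L2_set (\<lambda>i. norm (ell2_nth (x - (\<Sum>i\<in>F. ell2_single i (ell2_nth x i))) i)) H \<le> e/2"
        using e unfolding L2_set_def by (intro real_le_lsqrt) (auto intro: sum_nonneg)
    qed
    then show ?case using e by (simp add: dist_norm norm_minus_commute)
  qed
qed

lemma pairing_bound:
  fixes f :: "('g, 'y::complex_normed_space dual) ell2"
  shows "(\<lambda>i. norm (cblinfun_apply (ell2_nth f i) (ell2_nth x i))) summable_on UNIV"
  "cmod (pairing f x) \<le> norm f * norm x"
proof -
  have *: "(\<Sum>i\<in>F. norm (cblinfun_apply (ell2_nth f i) (ell2_nth x i))) \<le> norm f * norm x"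
    if "finite F" for F
  proof -
    have "(\<Sum>i\<in>F. norm (cblinfun_apply (ell2_nth f i) (ell2_nth x i)))
        \<le> (\<Sum>i\<in>F. \<bar>norm (ell2_nth f i)\<bar> * \<bar>norm (ell2_nth x i)\<bar>)"
      by (intro sum_mono) (simp add: norm_cblinfun)
    also have "\<dots> \<le> L2_set (\<lambda>i. norm (ell2_nth f i)) F * L2_set (\<lambda>i. norm (ell2_nth x i)) F"
      by (rule L2_set_mult_ineq)
    also have "\<dots> \<le> norm f * norm x"
      by (intro mult_mono ell2_L2_set_le_norm that) auto
    finally show ?thesis .
  qed
  show s: "(\<lambda>i. norm (cblinfun_apply (ell2_nth f i) (ell2_nth x i))) summable_on UNIV"
    by (rule nonneg_bdd_above_summable_on) (auto intro!: bdd_aboveI[of _ "norm f * norm x"] *)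
  have "cmod (pairing f x) \<le> (\<Sum>\<^sub>\<infinity>i. norm (cblinfun_apply (ell2_nth f i) (ell2_nth x i)))"
    unfolding pairing_def by (rule norm_infsum_bound[OF s])
  also have "\<dots> \<le> norm f * norm x"
    by (rule infsum_le_finite_sums[OF s]) (use * in auto)
  finally show "cmod (pairing f x) \<le> norm f * norm x" .
qed

lemma pairing_summable:
  fixes f :: "('g, 'y::complex_normed_space dual) ell2"
  shows "(\<lambda>i. cblinfun_apply (ell2_nth f i) (ell2_nth x i)) summable_on UNIV"
  by (rule abs_summable_summable[OF pairing_bound(1)])

lemma pairing_linear:
  "pairing (f + g) x = pairing f x + pairing g x" "pairing (c *\<^sub>C f) x = c * pairing f x"
  "pairing f (x + y) = pairing f x + pairing f y" "pairing f (c *\<^sub>C x) = c * pairing f x"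
  unfolding pairing_def
  by (simp_all add: plus_ell2.rep_eq scaleC_ell2.rep_eq plus_cblinfun.rep_eq scaleC_cblinfun.rep_eq
      cblinfun_apply_add cblinfun_apply_scaleC scaleC_complex_def infsum_add pairing_summable
      infsum_cmult_right')

lemma pairing_single: "pairing f (ell2_single i y) = cblinfun_apply (ell2_nth f i) y"
proof -
  have "pairing f (ell2_single i y) =
      (\<Sum>\<^sub>\<infinity>k\<in>{i}. cblinfun_apply (ell2_nth f k) (ell2_nth (ell2_single i y) k))"
    unfolding pairing_def
    by (rule infsum_cong_neutral)
      (auto simp: ell2_single.rep_eq, metis cblinfun_apply_add add_cancel_right_right)
  then show ?thesis by (simp add: ell2_single.rep_eq)
qed

lemma ell2_single_linear:
  "ell2_single i (x + y) = ell2_single i x + ell2_single i y"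
  "ell2_single i (c *\<^sub>C x) = c *\<^sub>C ell2_single i x"
  by (transfer, auto)+

lemma norm_ell2_single: "norm (ell2_single i y) \<le> norm y"
proof (rule norm_ell2_boundI)
  fix F :: "'a set" assume F: "finite F"
  have "(\<Sum>k\<in>F. (norm (ell2_nth (ell2_single i y) k))\<^sup>2) = (\<Sum>k\<in>F. if k = i then (norm y)\<^sup>2 else 0)"
    by (intro sum.cong refl) (auto simp: ell2_single.rep_eq)
  also have "\<dots> \<le> (norm y)\<^sup>2" using F by simp
  finally show "L2_set (\<lambda>k. norm (ell2_nth (ell2_single i y) k)) F \<le> norm y"
    unfolding L2_set_def by (intro real_le_lsqrt) (auto intro: sum_nonneg)
qed

text \<open>Every bounded functional is represented by a sequence in the dual, with the same bound.\<close>

lemma functional_representation_bound: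
  fixes \<phi> :: "('g, 'y::complex_normed_space) ell2 \<Rightarrow> complex" and t :: "'g \<Rightarrow> 'y dual"
  assumes \<phi>: "bounded_clinear \<phi>" and C: "\<And>x. cmod (\<phi> x) \<le> C * norm x"
    and t: "\<And>i y. cblinfun_apply (t i) y = \<phi> (ell2_single i y)"
    and F: "finite F" and "0 \<le> C"
  shows "L2_set (\<lambda>i. norm (t i)) F \<le> C"
proof -
  let ?s = "L2_set (\<lambda>i. norm (t i)) F"
  have add: "\<phi> (x + y) = \<phi> x + \<phi> y" and scale: "\<phi> (c *\<^sub>C x) = c * \<phi> x" for x y c
    using \<phi> by (auto simp: bounded_clinear_def scaleC_complex_def bounded_linear.linear linear_add)
  have sum: "\<phi> (sum h H) = (\<Sum>i\<in>H. \<phi> (h i))" for h :: "'g \<Rightarrow> ('g, 'y) ell2" and H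
    using \<phi> by (simp add: bounded_clinear_def bounded_linear.linear linear_sum)
  have main: "d * ?s \<le> C" if d: "0 < d" "d < 1" for d :: real
  proof (cases "?s = 0")
    case False
    have "\<exists>y. norm y \<le> 1 \<and> (\<exists>r\<ge>d * norm (t i). cblinfun_apply (t i) y = complex_of_real r)" for i
    proof (cases "norm (t i) = 0")
      case True
      then show ?thesis
        by (intro exI[of _ 0] conjI exI[of _ "0::real"]) (auto simp: zero_cblinfun.rep_eq)
    next
      case False
      then have "d * norm (t i) < norm (t i)" "0 \<le> d * norm (t i)" using d by auto
      then obtain z where z: "norm (cblinfun_apply (t i) z) > d * norm (t i) * norm z"
        using norm_cblinfun_bound[of "d * norm (t i)" "t i"] by (meson not_le)
      then have z0: "z \<noteq> 0" and az: "cblinfun_apply (t i) z \<noteq> 0"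
        using \<open>0 \<le> d * norm (t i)\<close>
         apply (metis cblinfun_apply_add add_cancel_right_right norm_zero mult_zero_right less_irrefl)
        using z \<open>0 \<le> d * norm (t i)\<close> by (metis mult_nonneg_nonneg norm_ge_zero norm_zero not_le)
      define a where "a = cblinfun_apply (t i) z"
      define c where "c = cnj a / complex_of_real (cmod a * norm z)"
      have a: "a \<noteq> 0" using az a_def by simp
      have "cblinfun_apply (t i) (c *\<^sub>C z) = c * a"
        by (simp add: cblinfun_apply_scaleC scaleC_complex_def a_def)
      also have "c * a = complex_of_real (cmod a / norm z)"
        using a z0 complex_norm_square[of a]
        by (simp add: c_def field_simps power2_eq_square)
      finally have "cblinfun_apply (t i) (c *\<^sub>C z) = complex_of_real (cmod a / norm z)" .
      moreover have "d * norm (t i) \<le> cmod a / norm z"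
        using z z0 by (simp add: a_def field_simps)
      moreover have "norm (c *\<^sub>C z) \<le> 1"
        using a z0 by (simp add: norm_scaleC c_def norm_divide norm_mult)
      ultimately show ?thesis by blast
    qed
    then obtain y r where y: "\<And>i. norm (y i) \<le> 1" and r: "\<And>i. d * norm (t i) \<le> r i"
      and ty: "\<And>i. cblinfun_apply (t i) (y i) = complex_of_real (r i)"
      by metis
    define x where "x = (\<Sum>i\<in>F. ell2_single i (complex_of_real (norm (t i)) *\<^sub>C y i))"
    have nx: "norm x \<le> ?s"
    proof (rule norm_ell2_boundI)
      fix H :: "'g set" assume H: "finite H"
      have "(\<Sum>i\<in>H. (norm (ell2_nth x i))\<^sup>2) \<le> (\<Sum>i\<in>H. if i \<in> F then (norm (t i))\<^sup>2 else 0)"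
      proof (intro sum_mono)
        fix i
        have "norm (t i) * norm (y i) \<le> norm (t i)"
          using y[of i] by (simp add: mult_left_le)
        then show "(norm (ell2_nth x i))\<^sup>2 \<le> (if i \<in> F then (norm (t i))\<^sup>2 else 0)"
          using F by (auto simp: x_def ell2_nth_sum_single norm_scaleC intro!: power_mono)
      qed
      also have "\<dots> = (\<Sum>i\<in>H \<inter> F. (norm (t i))\<^sup>2)"
        using H by (simp add: sum.inter_restrict)
      also have "\<dots> \<le> (\<Sum>i\<in>F. (norm (t i))\<^sup>2)"
        using F by (intro sum_mono2) auto
      finally show "L2_set (\<lambda>i. norm (ell2_nth x i)) H \<le> ?s"
        unfolding L2_set_def by simp
    qed
    have "\<phi> x = complex_of_real (\<Sum>i\<in>F. norm (t i) * r i)"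
      by (simp add: x_def sum ell2_single_linear scale t[symmetric] ty)
    then have "cmod (\<phi> x) = \<bar>\<Sum>i\<in>F. norm (t i) * r i\<bar>"
      by (simp only: norm_of_real)
    moreover have "(\<Sum>i\<in>F. norm (t i) * (d * norm (t i))) \<le> (\<Sum>i\<in>F. norm (t i) * r i)"
      by (intro sum_mono mult_left_mono r) auto
    moreover have "(\<Sum>i\<in>F. norm (t i) * (d * norm (t i))) = d * ?s\<^sup>2"
      by (simp add: L2_set_def sum_nonneg sum_distrib_left power2_eq_square mult_ac)
    ultimately have "d * ?s\<^sup>2 \<le> C * norm x"
      using C[of x] by linarith
    also have "\<dots> \<le> C * ?s" by (intro mult_left_mono nx assms)
    finally have "(d * ?s) * ?s \<le> C * ?s" by (simp add: power2_eq_square mult.assoc)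
    moreover have "0 < ?s" using False L2_set_nonneg[of "\<lambda>i. norm (t i)" F] by linarith
    ultimately show ?thesis by simp
  qed (use assms in auto)
  have "((\<lambda>d. d * ?s) \<longlongrightarrow> 1 * ?s) (at_left (1::real))"
    by (intro tendsto_intros)
  moreover have "\<forall>\<^sub>F d in at_left (1::real). d * ?s \<le> C"
    using main by (intro eventually_at_leftI[of 0]) auto
  ultimately show ?thesis
    using tendsto_upperbound[of "\<lambda>d. d * ?s" "1 * ?s" "at_left 1" C] by simp
qed

lemma adj_op_ex1:
  fixes A :: "(('g, 'y::complex_normed_space) ell2, ('g, 'y) ell2) cblinfun"
  shows "\<exists>!B. \<forall>f x. pairing (cblinfun_apply B f) x = pairing f (cblinfun_apply A x)"
proof (rule ex_ex1I)
  define \<phi> where "\<phi> f x = pairing f (cblinfun_apply A x)"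
    for f :: "('g, 'y dual) ell2" and x
  have \<phi>_lin: "\<phi> (f + g) x = \<phi> f x + \<phi> g x" "\<phi> (c *\<^sub>C f) x = c * \<phi> f x"
    "\<phi> f (x + y) = \<phi> f x + \<phi> f y" "\<phi> f (c *\<^sub>C x) = c * \<phi> f x" for f g x y c
    by (simp_all add: \<phi>_def pairing_linear cblinfun_apply_add cblinfun_apply_scaleC)
  have \<phi>_bound: "cmod (\<phi> f x) \<le> (norm A * norm f) * norm x" for f x
  proof -
    have "cmod (\<phi> f x) \<le> norm f * (norm A * norm x)"
      unfolding \<phi>_def
      by (intro order_trans[OF pairing_bound(2)] mult_left_mono norm_cblinfun) auto
    then show ?thesis by (simp add: mult_ac)
  qed
  have \<phi>_bcl: "bounded_clinear (\<phi> f)" for f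
    by (rule bounded_clinearI[OF _ _ \<phi>_bound]) (simp_all add: \<phi>_lin scaleC_complex_def)
  define t where "t f i = Abs_cblinfun (\<lambda>y. \<phi> f (ell2_single i y))"
    for f :: "('g, 'y dual) ell2" and i
  have t: "cblinfun_apply (t f i) y = \<phi> f (ell2_single i y)" for f i y
  proof -
    have "bounded_clinear (\<lambda>y. \<phi> f (ell2_single i y))"
    proof (rule bounded_clinearI)
      show "norm (\<phi> f (ell2_single i y)) \<le> (norm A * norm f) * norm y" for y
        by (intro order_trans[OF \<phi>_bound] mult_left_mono norm_ell2_single) auto
    qed (simp_all add: ell2_single_linear \<phi>_lin scaleC_complex_def)
    then show ?thesis by (simp add: t_def Abs_cblinfun_inverse)
  qed
  let ?B = "Abs_cblinfun (\<lambda>f. Abs_ell2 (t f))"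
  have B: "ell2_nth (cblinfun_apply ?B f) = t f" for f
  proof (rule coordinatewise_operator)
    show "t (f + g) i = t f i + t g i" "t (c *\<^sub>C f) i = c *\<^sub>C t f i" for f g c i
      by (auto simp: cblinfun_apply_inject[symmetric] t \<phi>_lin plus_cblinfun.rep_eq
          scaleC_cblinfun.rep_eq scaleC_complex_def fun_eq_iff)
    show "L2_set (\<lambda>i. norm (t f i)) F \<le> norm A * norm f" if "finite F" for f F
      by (rule functional_representation_bound[OF \<phi>_bcl \<phi>_bound t that]) auto
  qed
  have "pairing (cblinfun_apply ?B f) x = pairing f (cblinfun_apply A x)" for f x
  proof -
    have "bounded_linear (\<phi> f)" using \<phi>_bcl by (simp add: bounded_clinear_def)
    from has_sum_bounded_linear[OF this has_sum_ell2_single[of x]]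
    have "((\<lambda>i. \<phi> f (ell2_single i (ell2_nth x i))) has_sum \<phi> f x) UNIV"
      by (simp add: o_def)
    then have "(\<Sum>\<^sub>\<infinity>i. \<phi> f (ell2_single i (ell2_nth x i))) = \<phi> f x"
      by (rule infsumI)
    then show ?thesis by (simp add: pairing_def[of "cblinfun_apply ?B f"] B t) (simp add: \<phi>_def)
  qed
  then show "\<exists>B. \<forall>f x. pairing (cblinfun_apply B f) x = pairing f (cblinfun_apply A x)"
    by blast
next
  fix B C :: "(('g, 'y dual) ell2, ('g, 'y dual) ell2) cblinfun"
  assume B: "\<forall>f x. pairing (cblinfun_apply B f) x = pairing f (cblinfun_apply A x)"
    and C: "\<forall>f x. pairing (cblinfun_apply C f) x = pairing f (cblinfun_apply A x)"
  have "cblinfun_apply (ell2_nth (cblinfun_apply B f) i) y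
      = cblinfun_apply (ell2_nth (cblinfun_apply C f) i) y" for f i y
    by (metis B C pairing_single)
  then show "B = C"
    by (metis cblinfun_apply_inject ell2_nth_inject ext)
qed

lemma pairing_adj_op:
  "pairing (cblinfun_apply (adj_op A) f) x = pairing f (cblinfun_apply A x)"
  unfolding adj_op_def using theI'[OF adj_op_ex1[of A]] by blast

section \<open>Operators in the Wiener algebra\<close>

definition sup_norm :: "('g \<Rightarrow> 'z::real_normed_vector) \<Rightarrow> real" where
  "sup_norm c = (SUP i. norm (c i))"

text \<open>The series converges in operator norm.\<close>

definition wiener_rep ::
  "('g::ab_group_add \<Rightarrow> 'g \<Rightarrow> ('y::complex_normed_space, 'y) cblinfun) \<Rightarrow>
   (('g, 'y) ell2, ('g, 'y) ell2) cblinfun \<Rightarrow> bool" where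
  "wiener_rep b A \<longleftrightarrow>
     (\<forall>j. bounded (range (b j))) \<and>
     (\<lambda>j. sup_norm (b j)) summable_on UNIV \<and>
     ((\<lambda>j. mult_op (b j) o\<^sub>C shift_op j) has_sum A) UNIV"

text \<open>\<open>powr\<close> satisfies \<open>0 powr 0 = 0\<close>, which is the convention required for \<open>p = 0\<close>.\<close>

definition wiener_class ::
  "real \<Rightarrow> (('g::ab_group_add, 'y::complex_normed_space) ell2, ('g, 'y) ell2) cblinfun set" where
  "wiener_class p = {A. \<exists>b. wiener_rep b A \<and> (\<lambda>j. sup_norm (b j) powr p) summable_on UNIV}"

section \<open>Lower norms and pseudospectra\<close>

text \<open>The lower norm of the restriction of \<open>B\<close> to the subspace \<open>S\<close>; it is \<open>\<infinity>\<close> if \<open>S\<close> is trivial.\<close>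

definition lower_norm ::
  "'a::complex_normed_space set \<Rightarrow> ('a, 'b::complex_normed_space) cblinfun \<Rightarrow> ereal" where
  "lower_norm S B = (INF x\<in>{x \<in> S. norm x = 1}. ereal (norm (cblinfun_apply B x)))"

definition mu ::
  "(('g, 'y::complex_normed_space) ell2, ('g, 'y) ell2) cblinfun \<Rightarrow> ereal" where
  "mu B = min (lower_norm UNIV B) (lower_norm UNIV (adj_op B))"

definition spec_open ::
  "real \<Rightarrow> (('g, 'y::complex_normed_space) ell2, ('g, 'y) ell2) cblinfun \<Rightarrow> complex set" where
  "spec_open \<epsilon> A = {z. mu (A - z *\<^sub>C cblinfun_id) < ereal \<epsilon>}"

definition spec_closed ::
  "real \<Rightarrow> (('g, 'y::complex_normed_space) ell2, ('g, 'y) ell2) cblinfun \<Rightarrow> complex set" where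
  "spec_closed \<epsilon> A = {z. mu (A - z *\<^sub>C cblinfun_id) \<le> ereal \<epsilon>}"

definition window :: "'g::ab_group_add set \<Rightarrow> 'g \<Rightarrow> 'g set" where
  "window W k = (\<lambda>w. k + w) ` W"

definition patch ::
  "'g::ab_group_add set \<Rightarrow> (('g, 'y::complex_normed_space) ell2, ('g, 'y) ell2) cblinfun \<Rightarrow> 'g \<Rightarrow>
   (('g, 'y) ell2, ('g, 'y) ell2) cblinfun" where
  "patch W B k = B o\<^sub>C cutoff_op (window W k)"

text \<open>The lower norm of the rectangular operator \<open>B\<^sub>k - zI\<^sub>k\<close>: since \<open>lower_norm\<close> restricts its
  argument to the sequences supported in \<open>k + W\<close>, the identity becomes the embedding \<open>I\<^sub>k\<close>.\<close>

definition patch_lower_norm ::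
  "'g::ab_group_add set \<Rightarrow> (('g, 'y::complex_normed_space) ell2, ('g, 'y) ell2) cblinfun \<Rightarrow>
   complex \<Rightarrow> 'g \<Rightarrow> ereal" where
  "patch_lower_norm W B z k =
     lower_norm (ell2_on (window W k)) (patch W B k - z *\<^sub>C cblinfun_id)"

definition patch_spec_open ::
  "real \<Rightarrow> 'g::ab_group_add set \<Rightarrow> (('g, 'y::complex_normed_space) ell2, ('g, 'y) ell2) cblinfun \<Rightarrow>
   'g \<Rightarrow> complex set" where
  "patch_spec_open \<epsilon> W B k = {z. patch_lower_norm W B z k < ereal \<epsilon>}"

definition patch_spec_closed ::
  "real \<Rightarrow> 'g::ab_group_add set \<Rightarrow> (('g, 'y::complex_normed_space) ell2, ('g, 'y) ell2) cblinfun \<Rightarrow>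
   'g \<Rightarrow> complex set" where
  "patch_spec_closed \<epsilon> W B k = {z. patch_lower_norm W B z k \<le> ereal \<epsilon>}"

definition gamma_open ::
  "real \<Rightarrow> 'g::ab_group_add set \<Rightarrow> (('g, 'y::complex_normed_space) ell2, ('g, 'y) ell2) cblinfun \<Rightarrow>
   complex set" where
  "gamma_open \<epsilon> W A =
     {z. (INF k. min (patch_lower_norm W A z k) (patch_lower_norm W (adj_op A) z k)) < ereal \<epsilon>}"

definition gamma_closed ::
  "real \<Rightarrow> 'g::ab_group_add set \<Rightarrow> (('g, 'y::complex_normed_space) ell2, ('g, 'y) ell2) cblinfun \<Rightarrow>
   complex set" where
  "gamma_closed \<epsilon> W A =
     {z. (INF k. min (patch_lower_norm W A z k) (patch_lower_norm W (adj_op A) z k)) \<le> ereal \<epsilon>}"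

section \<open>The Dirichlet Laplacian and the truncation error\<close>

text \<open>An operator on the sequences supported in the finite set \<open>W\<close>.\<close>

definition dirichlet_laplacian ::
  "('g \<Rightarrow> 'g \<Rightarrow> real) \<Rightarrow> 'g set \<Rightarrow> ('g, complex) ell2 \<Rightarrow> ('g, complex) ell2" where
  "dirichlet_laplacian e W x = Abs_ell2 (\<lambda>k.
     if k \<in> W then
       (\<Sum>l\<in>W. complex_of_real (e k l) * (ell2_nth x k - ell2_nth x l))
       + complex_of_real (\<Sum>\<^sub>\<infinity>l\<in>-W. e k l) * ell2_nth x k
     else 0)"

lemma dirichlet_laplacian_nth:
  assumes "finite W"
  shows "ell2_nth (dirichlet_laplacian e W x) k =
    (if k \<in> W then
       (\<Sum>l\<in>W. complex_of_real (e k l) * (ell2_nth x k - ell2_nth x l))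
       + complex_of_real (\<Sum>\<^sub>\<infinity>l\<in>-W. e k l) * ell2_nth x k
     else 0)"
proof -
  have fin: "(\<lambda>k. (norm (if k \<in> W then h k else (0::complex)))\<^sup>2) summable_on UNIV" for h
  proof (subst summable_on_cong_neutral[where T = W])
    show "(\<lambda>k. (norm (if k \<in> W then h k else 0))\<^sup>2) summable_on W"
      using assms by simp
  qed auto
  show ?thesis
    unfolding dirichlet_laplacian_def by (subst Abs_ell2_inverse) (auto intro!: fin)
qed

text \<open>The spectrum of a bounded operator \<open>T\<close> on the complete subspace \<open>S\<close>.\<close>

definition spectrum_on :: "'a::complex_normed_space set \<Rightarrow> ('a \<Rightarrow> 'a) \<Rightarrow> complex set" where
  "spectrum_on S T = {z. \<not> bij_betw (\<lambda>x. T x - z *\<^sub>C x) S S}"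

definition mean_norm ::
  "('g::ab_group_add \<Rightarrow> 'g \<Rightarrow> ('y::complex_normed_space, 'y) cblinfun) \<Rightarrow> 'g \<Rightarrow> real" where
  "mean_norm b j = (sup_norm (b j) + sup_norm (b (- j))) / 2"

definition edge_weight ::
  "real \<Rightarrow> ('g::ab_group_add \<Rightarrow> 'g \<Rightarrow> ('y::complex_normed_space, 'y) cblinfun) \<Rightarrow>
   'g \<Rightarrow> 'g \<Rightarrow> real" where
  "edge_weight p b k l = (if k = l then 0 else 2 * mean_norm b (k - l) powr p)"

definition truncation_error ::
  "real \<Rightarrow> 'g::ab_group_add set \<Rightarrow>
   ('g \<Rightarrow> 'g \<Rightarrow> ('y::complex_normed_space, 'y) cblinfun) \<Rightarrow> real" where
  "truncation_error p W b =
     sqrt (\<Sum>\<^sub>\<infinity>j\<in>-{0}. mean_norm b j powr (2 - p)) *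
     sqrt (LEAST r. complex_of_real r \<in>
       spectrum_on (ell2_on W) (dirichlet_laplacian (edge_weight p b) W))"

end

theory Submission
  imports Defs
begin

text \<open>
  The lower inclusions hold because a patch of \<open>A - z\<close> is a restriction of \<open>A - z\<close>, so that its lower
  norm is at least that of \<open>A - z\<close>, and likewise for the adjoint.

  For the upper inclusions, an approximate minimiser of \<open>norm ((A - z) x)\<close> has to be localised to a
  window. Take a weight \<open>\<phi>\<close> supported in \<open>W\<close> with \<open>\<Sum> \<phi> i ^ 2 = 1\<close> and let \<open>m k\<close> be multiplication
  by its translate to \<open>k + W\<close>. The operators \<open>m k\<close> preserve norms in the square mean over \<open>k\<close>, so on
  average over \<open>k\<close> the sequences \<open>m k x\<close> are as good as \<open>x\<close>, up to the commutators of \<open>A\<close> with the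
  \<open>m k\<close> (\<open>window_lower_norm_le\<close>). The diagonal \<open>j\<close> of \<open>A\<close> contributes to the commutators at most
  the norm of its coefficients times the distance \<open>d j\<close> between \<open>\<phi>\<close> and its translate by \<open>j\<close>
  (\<open>commutator_sum_bound\<close>). Because \<open>d (- j) = d j\<close>, coefficient norms may be replaced by their means
  over \<open>j\<close> and \<open>- j\<close>, and the Cauchy-Schwarz inequality separates \<open>\<Sum> mean j powr (2 - p)\<close> from
  \<open>\<Sum> mean j powr p * d j ^ 2\<close>. The latter is the Dirichlet form of the graph Laplacian at \<open>\<phi>\<close>
  (\<open>dirichlet_form_eq_shift_defects\<close>), and the best choice of \<open>\<phi>\<close> is an eigenvector for the smallest
  eigenvalue. The argument uses of \<open>A\<close> only an entrywise bound on commutators with weights, which the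
  adjoint satisfies with reflected indices; the means do not see the reflection, so the same error
  serves for both (\<open>truncation_error_weight\<close>).

  The open sets are unions over the patches because an infimum is below \<open>\<epsilon>\<close> if and only if some term
  is. An infimum that is not attained breaks this for the closed sets: a weighted shift whose weights
  decrease to \<open>1\<close> has no column of norm at most \<open>1\<close>, but the column norms have infimum \<open>1\<close>
  (\<open>closed_patches_neither_union_nor_closure\<close>).
\<close>

section \<open>The smallest eigenvalue of a symmetric matrix\<close>

text \<open>The quadratic form attains its minimum \<open>m\<close> on the unit sphere, which is compact even as a subset
  of the product space of all real functions, since its elements vanish off \<open>W\<close> and are bounded by
  \<open>1\<close>. A minimiser \<open>\<phi>\<close> is an eigenvector: the form minus \<open>m\<close> times the squared norm is nonnegative and
  vanishes at \<open>\<phi>\<close>, so its derivative at \<open>\<phi>\<close> in the direction of the residual \<open>g\<close>, which is twice the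
  squared norm of \<open>g\<close>, has to vanish.\<close>

lemma symmetric_matrix_min_eigenvector:
  fixes M :: "'g \<Rightarrow> 'g \<Rightarrow> real"
  assumes W: "finite W" "W \<noteq> {}" and sym: "\<And>k l. M k l = M l k"
  obtains \<phi> m where "\<forall>i. i \<notin> W \<longrightarrow> \<phi> i = 0" "(\<Sum>i\<in>W. (\<phi> i)\<^sup>2) = 1"
    "\<forall>k\<in>W. (\<Sum>l\<in>W. M k l * \<phi> l) = m * \<phi> k"
    "\<forall>\<psi>. m * (\<Sum>i\<in>W. (\<psi> i)\<^sup>2) \<le> (\<Sum>k\<in>W. \<psi> k * (\<Sum>l\<in>W. M k l * \<psi> l))"
proof -
  define Q where "Q \<psi> = (\<Sum>k\<in>W. \<psi> k * (\<Sum>l\<in>W. M k l * \<psi> l))" for \<psi> :: "'g \<Rightarrow> real"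
  define N where "N \<psi> = (\<Sum>i\<in>W. (\<psi> i)\<^sup>2)" for \<psi> :: "'g \<Rightarrow> real"
  define K where "K = Pi\<^sub>E UNIV (\<lambda>i. if i \<in> W then {-1..1::real} else {0})"
  have coord: "continuous_on S (\<lambda>\<psi>::'g \<Rightarrow> real. \<psi> i)" for S i
    by (rule continuous_on_subset[OF continuous_on_product_coordinates]) simp
  have "compact K"
    unfolding K_def compactin_euclidean_iff[symmetric] euclidean_product_topology[symmetric]
    by (subst compactin_PiE) auto
  moreover have "closed {\<psi>. N \<psi> = 1}"
    unfolding N_def by (intro closed_Collect_eq continuous_intros coord)
  ultimately have "compact (K \<inter> {\<psi>. N \<psi> = 1})" by (rule compact_Int_closed)
  moreover obtain w where w: "w \<in> W" using W by blast
  have "(\<lambda>i. if i = w then 1 else 0) \<in> K \<inter> {\<psi>. N \<psi> = 1}"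
    using w W by (auto simp: K_def N_def if_distrib[of "\<lambda>x. x ^ 2"] PiE_iff cong: if_cong)
  then have "K \<inter> {\<psi>. N \<psi> = 1} \<noteq> {}" by blast
  moreover have "continuous_on (K \<inter> {\<psi>. N \<psi> = 1}) Q"
    unfolding Q_def by (intro continuous_intros coord)
  ultimately obtain \<phi> where \<phi>: "\<phi> \<in> K" "N \<phi> = 1"
    and min: "\<And>\<psi>. \<psi> \<in> K \<Longrightarrow> N \<psi> = 1 \<Longrightarrow> Q \<phi> \<le> Q \<psi>"
    using continuous_attains_inf[of "K \<inter> {\<psi>. N \<psi> = 1}" Q] by blast
  define m where "m = Q \<phi>"
  have low: "m * N \<psi> \<le> Q \<psi>" for \<psi>
  proof (cases "N \<psi> = 0")
    case True
    then have "\<psi> i = 0" if "i \<in> W" for i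
      using that W by (simp add: N_def sum_nonneg_eq_0_iff)
    then have "Q \<psi> = 0" by (simp add: Q_def)
    then show ?thesis using True by simp
  next
    case False
    then have n: "N \<psi> > 0" by (metis N_def less_eq_real_def sum_nonneg zero_le_power2)
    define \<eta> where "\<eta> i = (if i \<in> W then \<psi> i / sqrt (N \<psi>) else 0)" for i
    have N\<eta>: "N \<eta> = 1"
      using n by (simp add: N_def \<eta>_def power_divide sum_nonneg flip: sum_divide_distrib)
    have "\<bar>\<eta> i\<bar> \<le> 1" for i
    proof (cases "i \<in> W")
      case True
      then have "(\<eta> i)\<^sup>2 \<le> N \<eta>" unfolding N_def using W by (intro member_le_sum) auto
      then show ?thesis using N\<eta> by (simp add: abs_square_le_1)
    qed (simp add: \<eta>_def)
    moreover have zero: "\<eta> i = 0" if "i \<notin> W" for i using that by (simp add: \<eta>_def)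
    ultimately have "- 1 \<le> \<eta> i" "\<eta> i \<le> 1" for i using abs_le_iff minus_le_iff by metis+
    then have "\<eta> \<in> K" using zero by (simp add: K_def PiE_iff)
    then have "m \<le> Q \<eta>" unfolding m_def using N\<eta> by (intro min)
    also have "Q \<eta> = (\<Sum>k\<in>W. \<psi> k / sqrt (N \<psi>) * (\<Sum>l\<in>W. M k l * \<psi> l / sqrt (N \<psi>)))"
      by (simp add: Q_def \<eta>_def)
    also have "\<dots> = Q \<psi> / (sqrt (N \<psi>) * sqrt (N \<psi>))"
      by (simp add: Q_def flip: sum_divide_distrib)
    also have "\<dots> = Q \<psi> / N \<psi>" using n by simp
    finally show ?thesis using n by (simp add: field_simps)
  qed
  define g where "g k = (\<Sum>l\<in>W. M k l * \<phi> l) - m * \<phi> k" for k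
  have expand: "Q (\<lambda>i. \<phi> i - t * g i) - m * N (\<lambda>i. \<phi> i - t * g i)
      = - 2 * t * N g + t\<^sup>2 * (Q g - m * N g)" for t
  proof -
    have swap: "(\<Sum>k\<in>W. \<phi> k * (\<Sum>l\<in>W. M k l * g l)) = (\<Sum>k\<in>W. g k * (\<Sum>l\<in>W. M k l * \<phi> l))"
      unfolding sum_distrib_left by (subst sum.swap) (simp add: sym mult_ac)
    have "(\<Sum>k\<in>W. g k * (\<Sum>l\<in>W. M k l * \<phi> l)) = (\<Sum>k\<in>W. (g k)\<^sup>2 + m * (g k * \<phi> k))"
      by (intro sum.cong refl) (simp add: g_def algebra_simps power2_eq_square)
    then have c: "(\<Sum>k\<in>W. g k * (\<Sum>l\<in>W. M k l * \<phi> l)) = N g + m * (\<Sum>k\<in>W. g k * \<phi> k)"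
      by (simp add: N_def sum.distrib sum_distrib_left)
    have "Q (\<lambda>i. \<phi> i - t * g i) = (\<Sum>k\<in>W. \<phi> k * (\<Sum>l\<in>W. M k l * \<phi> l)
        - t * (\<phi> k * (\<Sum>l\<in>W. M k l * g l)) - t * (g k * (\<Sum>l\<in>W. M k l * \<phi> l))
        + t\<^sup>2 * (g k * (\<Sum>l\<in>W. M k l * g l)))"
      unfolding Q_def
    proof (intro sum.cong refl)
      fix k
      have "(\<Sum>l\<in>W. M k l * (\<phi> l - t * g l)) = (\<Sum>l\<in>W. M k l * \<phi> l) - t * (\<Sum>l\<in>W. M k l * g l)"
        by (simp add: right_diff_distrib sum_subtractf sum_distrib_left mult_ac)
      then show "(\<phi> k - t * g k) * (\<Sum>l\<in>W. M k l * (\<phi> l - t * g l)) = \<phi> k * (\<Sum>l\<in>W. M k l * \<phi> l)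
        - t * (\<phi> k * (\<Sum>l\<in>W. M k l * g l)) - t * (g k * (\<Sum>l\<in>W. M k l * \<phi> l))
        + t\<^sup>2 * (g k * (\<Sum>l\<in>W. M k l * g l))"
        by (simp only:) (simp add: algebra_simps power2_eq_square)
    qed
    also have "\<dots> = Q \<phi> - 2 * t * (N g + m * (\<Sum>k\<in>W. g k * \<phi> k)) + t\<^sup>2 * Q g"
      by (simp add: sum.distrib sum_subtractf flip: sum_distrib_left)
        (simp add: swap c Q_def)
    finally have 1: "Q (\<lambda>i. \<phi> i - t * g i)
      = m - 2 * t * (N g + m * (\<Sum>k\<in>W. g k * \<phi> k)) + t\<^sup>2 * Q g" by (simp add: m_def)
    have "N (\<lambda>i. \<phi> i - t * g i) = (\<Sum>k\<in>W. (\<phi> k)\<^sup>2 - 2 * t * (g k * \<phi> k) + t\<^sup>2 * (g k)\<^sup>2)"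
      unfolding N_def by (intro sum.cong refl) (simp add: algebra_simps power2_eq_square)
    also have "\<dots> = 1 - 2 * t * (\<Sum>k\<in>W. g k * \<phi> k) + t\<^sup>2 * N g"
      using \<phi>(2) by (simp add: sum.distrib sum_subtractf N_def flip: sum_distrib_left)
    finally show ?thesis unfolding 1 by (simp only:) (simp add: algebra_simps)
  qed
  have "N g = 0"
  proof (rule ccontr)
    assume "N g \<noteq> 0"
    then have n: "N g > 0" by (metis N_def less_eq_real_def sum_nonneg zero_le_power2)
    define c where "c = \<bar>Q g - m * N g\<bar> + 1"
    have c: "c > 0" by (simp add: c_def)
    \<comment> \<open>A step short enough that the linear term outweighs the quadratic one.\<close>
    define t where "t = N g / c"
    have t: "t > 0" using n c by (simp add: t_def)
    have "0 \<le> - 2 * t * N g + t\<^sup>2 * (Q g - m * N g)"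
      using low[of "\<lambda>i. \<phi> i - t * g i"] unfolding expand[symmetric] by simp
    also have "\<dots> \<le> - 2 * t * N g + t\<^sup>2 * c" by (simp add: c_def mult_left_mono)
    also have "\<dots> = - t * N g" using c by (simp add: t_def power2_eq_square)
    also have "\<dots> < 0" using t n by simp
    finally show False by simp
  qed
  then have "g k = 0" if "k \<in> W" for k
    using that W by (simp add: N_def sum_nonneg_eq_0_iff)
  then have eig: "\<forall>k\<in>W. (\<Sum>l\<in>W. M k l * \<phi> l) = m * \<phi> k"
    by (simp add: g_def)
  have "\<phi> i \<in> (if i \<in> W then {-1..1} else {0})" for i
    using \<phi>(1) unfolding K_def by (rule PiE_mem) simp
  then have supp: "\<forall>i. i \<notin> W \<longrightarrow> \<phi> i = 0" by (metis singletonD)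
  show thesis
    using that[OF supp \<phi>(2)[unfolded N_def] eig] low unfolding N_def Q_def by blast
qed

section \<open>Spectra on finitely supported sequences\<close>

lemma ell2_eqI: "(\<And>i. ell2_nth x i = ell2_nth y i) \<Longrightarrow> x = y"
  by (simp add: ell2_nth_inject[symmetric] fun_eq_iff)

lemma finite_support_eq_sum_single:
  assumes "finite W" "x \<in> ell2_on W"
  shows "x = (\<Sum>w\<in>W. ell2_single w (ell2_nth x w))"
  using assms by (intro ell2_eqI) (simp add: ell2_nth_sum_single ell2_on_def)

text \<open>The image of a basis of the space under \<open>T\<close> is independent and as large as the basis; if it did not
  span the space, it could be enlarged, contradicting the exchange lemma. Hence the spectrum on
  finitely supported sequences consists of eigenvalues.\<close>

lemma injective_imp_bij_betw_ell2_on: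
  fixes T :: "('g, complex) ell2 \<Rightarrow> ('g, complex) ell2"
  assumes W: "finite W"
    and add: "\<And>x y. T (x + y) = T x + T y" and scale: "\<And>c x. T (c *\<^sub>C x) = c *\<^sub>C T x"
    and into: "\<And>x. x \<in> ell2_on W \<Longrightarrow> T x \<in> ell2_on W"
    and ker: "\<And>x. x \<in> ell2_on W \<Longrightarrow> T x = 0 \<Longrightarrow> x = 0"
  shows "bij_betw T (ell2_on W) (ell2_on W)"
proof -
  interpret V: vector_space "scaleC :: complex \<Rightarrow> ('g, complex) ell2 \<Rightarrow> _"
    by (rule vector_space_scaleC)
  interpret L: Vector_Spaces.linear "scaleC :: complex \<Rightarrow> ('g, complex) ell2 \<Rightarrow> _"
      "scaleC :: complex \<Rightarrow> ('g, complex) ell2 \<Rightarrow> _" T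
    by unfold_locales (simp_all add: add scale)
  let ?S = "ell2_on W :: ('g, complex) ell2 set"
  define E where "E = (\<lambda>w. ell2_single w (1::complex)) ` W"
  have sub: "V.subspace ?S"
    by (rule V.subspaceI) (auto simp: ell2_on_def zero_ell2.rep_eq plus_ell2.rep_eq scaleC_ell2.rep_eq)
  have E: "finite E" "E \<subseteq> ?S" using W by (auto simp: E_def ell2_on_def ell2_single.rep_eq)
  have gen: "?S \<subseteq> V.span E"
  proof
    fix x :: "('g, complex) ell2" assume x: "x \<in> ?S"
    have *: "ell2_single w (ell2_nth x w) = ell2_nth x w *\<^sub>C ell2_single w 1" for w
      by (simp add: scaleC_complex_def flip: ell2_single_linear)
    show "x \<in> V.span E"
      by (subst finite_support_eq_sum_single[OF W x], subst *,
          rule V.span_sum, rule V.span_scale, rule V.span_base) (simp add: E_def)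
  qed
  obtain B where B: "B \<subseteq> ?S" "V.independent B" "?S \<subseteq> V.span B"
    by (rule V.maximal_independent_subset)
  have spanB: "V.span B = ?S"
    using B V.span_minimal[OF _ sub] by blast
  have finB: "finite B"
    using V.independent_span_bound[OF E(1) B(2)] B gen by blast
  have inj: "inj_on T ?S"
    unfolding L.inj_on_iff_eq_0[OF sub] using ker by blast
  have ind: "V.independent (T ` B)"
    by (rule L.independent_injective_image[OF B(2)]) (simp add: spanB inj)
  have cardTB: "card (T ` B) = card B"
    using card_image inj_on_subset[OF inj B(1)] by blast
  have "?S \<subseteq> V.span (T ` B)"
  proof (rule ccontr)
    assume "\<not> ?S \<subseteq> V.span (T ` B)"
    then obtain y where y: "y \<in> ?S" "y \<notin> V.span (T ` B)" by blast
    then have "y \<notin> T ` B" using V.span_base by blast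
    have "V.independent (insert y (T ` B))" using y(2) ind by (simp add: V.independent_insert)
    moreover have "insert y (T ` B) \<subseteq> V.span B" unfolding spanB using y(1) into B(1) by blast
    ultimately have "card (insert y (T ` B)) \<le> card B"
      using V.independent_span_bound[OF finB] by blast
    then show False using \<open>y \<notin> T ` B\<close> finB cardTB by simp
  qed
  then have "?S \<subseteq> T ` ?S" using L.span_image[of B] spanB by simp
  then show ?thesis unfolding bij_betw_def using inj into by blast
qed

text \<open>The Laplacian acts by a real symmetric matrix, so the smallest eigenvalue \<open>m\<close> of that matrix lies
  in the spectrum. Every real point \<open>r\<close> of the spectrum has a complex eigenvector, whose real or
  imaginary part is a real eigenvector and shows \<open>m \<le> r\<close>. The least real point of the spectrum thus
  exists and is the value of the Dirichlet form at a real eigenvector of norm one.\<close>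

lemma dirichlet_laplacian_min_eigenvector:
  fixes e :: "'g \<Rightarrow> 'g \<Rightarrow> real"
  assumes W: "finite W" "W \<noteq> {}" and sym: "\<And>k l. e k l = e l k"
  obtains \<phi> where "\<forall>i. i \<notin> W \<longrightarrow> \<phi> i = 0" "(\<Sum>i\<in>W. (\<phi> i)\<^sup>2) = 1"
    "(LEAST r. complex_of_real r \<in> spectrum_on (ell2_on W) (dirichlet_laplacian e W))
      = (\<Sum>k\<in>W. \<phi> k * ((\<Sum>l\<in>W. e k l * (\<phi> k - \<phi> l)) + (\<Sum>\<^sub>\<infinity>l\<in>-W. e k l) * \<phi> k))"
proof -
  define d where "d k = (\<Sum>l\<in>W. e k l) + (\<Sum>\<^sub>\<infinity>l\<in>-W. e k l)" for k
  define M where "M k l = (if k = l then d k else 0) - e k l" for k l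
  have M: "(\<Sum>l\<in>W. M k l * \<psi> l) = (\<Sum>l\<in>W. e k l * (\<psi> k - \<psi> l)) + (\<Sum>\<^sub>\<infinity>l\<in>-W. e k l) * \<psi> k"
    if "k \<in> W" for k and \<psi> :: "'g \<Rightarrow> real"
  proof -
    have "(\<Sum>l\<in>W. M k l * \<psi> l) = (\<Sum>l\<in>W. (if k = l then d k * \<psi> l else 0)) - (\<Sum>l\<in>W. e k l * \<psi> l)"
      unfolding sum_subtractf[symmetric] by (intro sum.cong refl) (simp add: M_def left_diff_distrib)
    also have "\<dots> = d k * \<psi> k - (\<Sum>l\<in>W. e k l * \<psi> l)" using that W by simp
    finally show ?thesis
      by (simp add: d_def right_diff_distrib sum_subtractf distrib_right sum_distrib_right)
  qed
  have nth: "ell2_nth (dirichlet_laplacian e W x) k =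
      Complex (\<Sum>l\<in>W. M k l * Re (ell2_nth x l)) (\<Sum>l\<in>W. M k l * Im (ell2_nth x l))"
    if "k \<in> W" for x k
    using that by (simp add: dirichlet_laplacian_nth[OF W(1)] M complex_eq_iff)
  have nth0: "ell2_nth (dirichlet_laplacian e W x) k = 0" if "k \<notin> W" for x k
    using that by (simp add: dirichlet_laplacian_nth[OF W(1)])
  have symM: "M k l = M l k" for k l using sym[of k l] by (auto simp: M_def)
  obtain \<phi> m where \<phi>: "\<forall>i. i \<notin> W \<longrightarrow> \<phi> i = 0" "(\<Sum>i\<in>W. (\<phi> i)\<^sup>2) = 1"
    and eig: "\<forall>k\<in>W. (\<Sum>l\<in>W. M k l * \<phi> l) = m * \<phi> k"
    and low: "\<forall>\<psi>. m * (\<Sum>i\<in>W. (\<psi> i)\<^sup>2) \<le> (\<Sum>k\<in>W. \<psi> k * (\<Sum>l\<in>W. M k l * \<psi> l))"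
    by (rule symmetric_matrix_min_eigenvector[of W M, OF W symM])
  have "(LEAST r. complex_of_real r \<in> spectrum_on (ell2_on W) (dirichlet_laplacian e W)) = m"
  proof (rule Least_equality)
    define u where "u = (\<Sum>w\<in>W. ell2_single w (complex_of_real (\<phi> w)))"
    have u: "ell2_nth u k = (if k \<in> W then complex_of_real (\<phi> k) else 0)" for k
      unfolding u_def using W(1) by (rule ell2_nth_sum_single)
    have "dirichlet_laplacian e W u - complex_of_real m *\<^sub>C u = 0"
    proof -
      have "ell2_nth (dirichlet_laplacian e W u) k = complex_of_real m * ell2_nth u k" for k
      proof (cases "k \<in> W")
        case True
        have "(\<Sum>l\<in>W. M k l * Re (ell2_nth u l)) = m * \<phi> k" "(\<Sum>l\<in>W. M k l * Im (ell2_nth u l)) = 0"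
          using eig[rule_format, OF True] by (simp_all add: u)
        then show ?thesis using True by (simp add: nth u complex_eq_iff)
      qed (simp add: nth0 u)
      then show ?thesis
        by (intro ell2_eqI) (simp add: minus_ell2.rep_eq zero_ell2.rep_eq scaleC_ell2.rep_eq
            scaleC_complex_def)
    qed
    moreover have "dirichlet_laplacian e W 0 - complex_of_real m *\<^sub>C 0 = 0"
      by (intro ell2_eqI) (simp add: dirichlet_laplacian_nth[OF W(1)] zero_ell2.rep_eq)
    moreover have "u \<noteq> 0"
    proof
      assume "u = 0"
      then have "complex_of_real (\<phi> k) = 0" if "k \<in> W" for k
        using u[of k] that by (simp add: zero_ell2.rep_eq)
      then show False using \<phi>(2) by simp
    qed
    moreover have "u \<in> ell2_on W" "0 \<in> ell2_on W" by (auto simp: ell2_on_def u zero_ell2.rep_eq)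
    ultimately have "\<not> inj_on (\<lambda>x. dirichlet_laplacian e W x - complex_of_real m *\<^sub>C x) (ell2_on W)"
      using inj_onD[of "\<lambda>x. dirichlet_laplacian e W x - complex_of_real m *\<^sub>C x" "ell2_on W" u 0]
      by auto
    then show "complex_of_real m \<in> spectrum_on (ell2_on W) (dirichlet_laplacian e W)"
      by (simp add: spectrum_on_def bij_betw_def)
  next
    fix r assume r: "complex_of_real r \<in> spectrum_on (ell2_on W) (dirichlet_laplacian e W)"
    define T where "T x = dirichlet_laplacian e W x - complex_of_real r *\<^sub>C x" for x
    have Tnth: "ell2_nth (T x) k = ell2_nth (dirichlet_laplacian e W x) k - complex_of_real r * ell2_nth x k"
      for x k by (simp add: T_def minus_ell2.rep_eq scaleC_ell2.rep_eq scaleC_complex_def)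
    have "\<exists>x\<in>ell2_on W. T x = 0 \<and> x \<noteq> 0"
    proof (rule ccontr)
      assume ker: "\<not> (\<exists>x\<in>ell2_on W. T x = 0 \<and> x \<noteq> 0)"
      have "bij_betw T (ell2_on W) (ell2_on W)"
      proof (rule injective_imp_bij_betw_ell2_on[OF W(1)])
        fix x y :: "('g, complex) ell2" and c
        have "ell2_nth (dirichlet_laplacian e W (x + y)) k
            = ell2_nth (dirichlet_laplacian e W x) k + ell2_nth (dirichlet_laplacian e W y) k" for k
          by (simp add: plus_ell2.rep_eq dirichlet_laplacian_nth[OF W(1)] add_diff_add distrib_left
              sum.distrib)
        then show "T (x + y) = T x + T y"
          by (intro ell2_eqI) (simp add: plus_ell2.rep_eq Tnth distrib_left)
        have "ell2_nth (dirichlet_laplacian e W (c *\<^sub>C x)) k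
            = c * ell2_nth (dirichlet_laplacian e W x) k" for k
          by (simp add: scaleC_ell2.rep_eq scaleC_complex_def dirichlet_laplacian_nth[OF W(1)]
              distrib_left sum_distrib_left right_diff_distrib mult.left_commute)
        then show "T (c *\<^sub>C x) = c *\<^sub>C T x"
          by (intro ell2_eqI) (simp add: scaleC_ell2.rep_eq scaleC_complex_def Tnth
              right_diff_distrib mult.left_commute)
        show "T x \<in> ell2_on W" if "x \<in> ell2_on W"
          using that by (auto simp: ell2_on_def Tnth nth0)
        show "x = 0" if "x \<in> ell2_on W" "T x = 0" using ker that by blast
      qed
      then show False using r by (simp add: spectrum_on_def T_def[abs_def])
    qed
    then obtain x where x: "x \<in> ell2_on W" "T x = 0" "x \<noteq> 0" by blast
    have eqn: "ell2_nth (dirichlet_laplacian e W x) k = complex_of_real r * ell2_nth x k" for k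
      using Tnth[of x k] x(2) by (simp add: zero_ell2.rep_eq)
    have parts: "(\<Sum>l\<in>W. M k l * Re (ell2_nth x l)) = r * Re (ell2_nth x k)"
        "(\<Sum>l\<in>W. M k l * Im (ell2_nth x l)) = r * Im (ell2_nth x k)" if "k \<in> W" for k
      using eqn[of k] nth[OF that, of x] by (simp_all add: complex_eq_iff)
    obtain k0 where k0: "ell2_nth x k0 \<noteq> 0"
      using x(3) by (metis ell2_nth_inject ext zero_ell2.rep_eq)
    then have k0W: "k0 \<in> W" using x(1) by (auto simp: ell2_on_def)
    have le: "m \<le> r" if "\<And>k. k \<in> W \<Longrightarrow> (\<Sum>l\<in>W. M k l * \<psi> l) = r * \<psi> k" "\<psi> k0 \<noteq> 0" for \<psi>
    proof -
      have "m * (\<Sum>i\<in>W. (\<psi> i)\<^sup>2) \<le> (\<Sum>k\<in>W. \<psi> k * (r * \<psi> k))"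
        using low[rule_format, of \<psi>] that(1) by simp
      also have "\<dots> = r * (\<Sum>i\<in>W. (\<psi> i)\<^sup>2)"
        unfolding sum_distrib_left power2_eq_square by (simp only: mult_ac)
      finally have *: "m * (\<Sum>i\<in>W. (\<psi> i)\<^sup>2) \<le> r * (\<Sum>i\<in>W. (\<psi> i)\<^sup>2)" .
      have "0 < (\<psi> k0)\<^sup>2" using that(2) by simp
      also have "\<dots> \<le> (\<Sum>i\<in>W. (\<psi> i)\<^sup>2)" using W(1) k0W by (intro member_le_sum) auto
      finally show ?thesis using * by (simp add: mult_le_cancel_right)
    qed
    show "m \<le> r"
    proof (cases "Re (ell2_nth x k0) = 0")
      case True
      then have "Im (ell2_nth x k0) \<noteq> 0" using k0 by (simp add: complex_eq_iff)
      then show ?thesis using le[of "\<lambda>k. Im (ell2_nth x k)"] parts by simp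
    next
      case False
      then show ?thesis using le[of "\<lambda>k. Re (ell2_nth x k)"] parts by simp
    qed
  qed
  also have "m = m * (\<Sum>k\<in>W. (\<phi> k)\<^sup>2)" by (simp add: \<phi>(2))
  also have "\<dots> = (\<Sum>k\<in>W. \<phi> k * (m * \<phi> k))"
    unfolding sum_distrib_left power2_eq_square by (simp only: mult_ac)
  also have "\<dots> = (\<Sum>k\<in>W. \<phi> k * ((\<Sum>l\<in>W. e k l * (\<phi> k - \<phi> l)) + (\<Sum>\<^sub>\<infinity>l\<in>-W. e k l) * \<phi> k))"
    by (intro sum.cong refl) (simp add: M[symmetric] eig)
  finally have least: "(LEAST r. complex_of_real r \<in> spectrum_on (ell2_on W) (dirichlet_laplacian e W))
      = (\<Sum>k\<in>W. \<phi> k * ((\<Sum>l\<in>W. e k l * (\<phi> k - \<phi> l)) + (\<Sum>\<^sub>\<infinity>l\<in>-W. e k l) * \<phi> k))" .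
  show thesis by (rule that[of \<phi>, OF \<phi> least])
qed

section \<open>Evaluating operators coordinatewise\<close>

lemma cblinfun_apply_minus_apply:
  "cblinfun_apply (A - B) x = cblinfun_apply A x - cblinfun_apply B x"
  by transfer simp

lemma cblinfun_apply_zero [simp]: "cblinfun_apply f 0 = 0"
  by (metis cblinfun_apply_add add_cancel_right_right)

lemma cblinfun_apply_diff: "cblinfun_apply f (x - y) = cblinfun_apply f x - cblinfun_apply f y"
  by (metis cblinfun_apply_add diff_add_cancel eq_diff_eq)

lemma cblinfun_apply_scaleR: "cblinfun_apply f (r *\<^sub>R x) = r *\<^sub>R cblinfun_apply f x"
  by (simp add: scaleR_scaleC cblinfun_apply_scaleC)

lemma scaleC_cblinfun_id_apply: "cblinfun_apply (z *\<^sub>C cblinfun_id) x = z *\<^sub>C x"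
  by (simp add: scaleC_cblinfun.rep_eq cblinfun_id.rep_eq)

lemma norm_ell2_square: "(norm x)\<^sup>2 = (\<Sum>\<^sub>\<infinity>i. (norm (ell2_nth x i))\<^sup>2)"
  unfolding norm_ell2.rep_eq by (simp add: infsum_nonneg)

lemma ell2_has_sum_norm: "((\<lambda>i. (norm (ell2_nth x i))\<^sup>2) has_sum (norm x)\<^sup>2) UNIV"
  unfolding norm_ell2_square by (rule has_sum_infsum[OF ell2_nth_summable])

definition weight_op ::
  "('g \<Rightarrow> real) \<Rightarrow> (('g, 'y::complex_normed_space) ell2, ('g, 'y) ell2) cblinfun" where
  "weight_op \<psi> = mult_op (\<lambda>i. \<psi> i *\<^sub>R cblinfun_id)"

lemma weight_op_nth:
  assumes "bounded (range \<psi>)"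
  shows "ell2_nth (cblinfun_apply (weight_op \<psi>) x) i = \<psi> i *\<^sub>R ell2_nth x i"
proof -
  obtain K where K: "\<bar>\<psi> i\<bar> \<le> K" for i using assms by (auto simp: bounded_iff)
  have "norm (\<psi> i *\<^sub>R (cblinfun_id :: ('b, 'b) cblinfun)) \<le> K * norm (cblinfun_id :: ('b, 'b) cblinfun)"
    for i using K by (simp add: mult_right_mono)
  then have "bounded (range (\<lambda>i. \<psi> i *\<^sub>R (cblinfun_id :: ('b, 'b) cblinfun)))"
    unfolding bounded_iff by blast
  then show ?thesis
    unfolding weight_op_def by (simp add: mult_op_nth scaleR_cblinfun.rep_eq cblinfun_id.rep_eq)
qed

section \<open>Translates of a finitely supported weight\<close>

text \<open>The norm of the difference between \<open>\<phi>\<close> and its translate by \<open>j\<close>, when \<open>\<phi>\<close> is supported in \<open>W\<close>: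
  the square is expanded, so that only finite sums over \<open>W\<close> occur.\<close>

definition shift_defect :: "'g::ab_group_add set \<Rightarrow> ('g \<Rightarrow> real) \<Rightarrow> 'g \<Rightarrow> real" where
  "shift_defect W \<phi> j = sqrt (2 * ((\<Sum>m\<in>W. (\<phi> m)\<^sup>2) - (\<Sum>m\<in>W. \<phi> (m - j) * \<phi> m)))"

lemma bounded_range_finite_support:
  fixes \<phi> :: "'g \<Rightarrow> real"
  assumes "finite W" "\<forall>i. i \<notin> W \<longrightarrow> \<phi> i = 0"
  shows "bounded (range \<phi>)"
proof -
  have "range \<phi> \<subseteq> insert 0 (\<phi> ` W)" using assms(2) by auto
  then show ?thesis using assms(1) by (meson bounded_subset finite_imageI finite_imp_bounded finite_insert)
qed

text \<open>All later uses of the translates are on finite index sets \<open>M\<close>. Enlarging \<open>M\<close> to contain the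
  supports of \<open>\<phi>\<close> and of its translate makes the expansion of the squares exact.\<close>

lemma sum_shift_difference_le:
  fixes \<phi> :: "'g::ab_group_add \<Rightarrow> real"
  assumes W: "finite W" and supp: "\<forall>i. i \<notin> W \<longrightarrow> \<phi> i = 0" and M: "finite M"
  shows "(\<Sum>m\<in>M. (\<phi> (m - j) - \<phi> m)\<^sup>2)
    \<le> 2 * ((\<Sum>m\<in>W. (\<phi> m)\<^sup>2) - (\<Sum>m\<in>W. \<phi> (m - j) * \<phi> m))"
proof -
  define H where "H = M \<union> W \<union> (\<lambda>m. m + j) ` W"
  have H: "finite H" "M \<subseteq> H" "W \<subseteq> H" using W M by (auto simp: H_def)
  have "(\<Sum>m\<in>M. (\<phi> (m - j) - \<phi> m)\<^sup>2) \<le> (\<Sum>m\<in>H. (\<phi> (m - j) - \<phi> m)\<^sup>2)"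
    by (intro sum_mono2 H) auto
  also have "\<dots> = (\<Sum>m\<in>H. (\<phi> (m - j))\<^sup>2 + (\<phi> m)\<^sup>2 - 2 * (\<phi> (m - j) * \<phi> m))"
    by (intro sum.cong refl) (simp add: power2_eq_square algebra_simps)
  also have "\<dots> = (\<Sum>m\<in>H. (\<phi> (m - j))\<^sup>2) + (\<Sum>m\<in>H. (\<phi> m)\<^sup>2) - 2 * (\<Sum>m\<in>H. \<phi> (m - j) * \<phi> m)"
    by (simp add: sum.distrib sum_subtractf sum_distrib_left)
  also have "(\<Sum>m\<in>H. (\<phi> m)\<^sup>2) = (\<Sum>m\<in>W. (\<phi> m)\<^sup>2)"
    using H supp by (intro sum.mono_neutral_right) auto
  also have "(\<Sum>m\<in>H. \<phi> (m - j) * \<phi> m) = (\<Sum>m\<in>W. \<phi> (m - j) * \<phi> m)"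
    using H supp by (intro sum.mono_neutral_right) auto
  also have "(\<Sum>m\<in>H. (\<phi> (m - j))\<^sup>2) = (\<Sum>m\<in>(\<lambda>m. m + j) ` W. (\<phi> (m - j))\<^sup>2)"
  proof (intro sum.mono_neutral_right H ballI)
    fix m assume m: "m \<in> H - (\<lambda>m. m + j) ` W"
    have "m - j \<notin> W"
    proof
      assume "m - j \<in> W"
      then have "m - j + j \<in> (\<lambda>m. m + j) ` W" by (rule imageI)
      then show False using m by simp
    qed
    then show "(\<phi> (m - j))\<^sup>2 = 0" using supp by simp
  qed (auto simp: H_def)
  also have "\<dots> = (\<Sum>m\<in>W. (\<phi> m)\<^sup>2)" by (subst sum.reindex) (auto simp: inj_on_def)
  finally show ?thesis by simp
qed

lemma shift_defect_nonneg:
  fixes \<phi> :: "'g::ab_group_add \<Rightarrow> real"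
  assumes "finite W" "\<forall>i. i \<notin> W \<longrightarrow> \<phi> i = 0"
  shows "0 \<le> shift_defect W \<phi> j"
    and "(shift_defect W \<phi> j)\<^sup>2 = 2 * ((\<Sum>m\<in>W. (\<phi> m)\<^sup>2) - (\<Sum>m\<in>W. \<phi> (m - j) * \<phi> m))"
  using sum_shift_difference_le[OF assms finite.emptyI, of j] by (simp_all add: shift_defect_def)

lemma shift_defect_uminus:
  fixes \<phi> :: "'g::ab_group_add \<Rightarrow> real"
  assumes W: "finite W" and supp: "\<forall>i. i \<notin> W \<longrightarrow> \<phi> i = 0"
  shows "shift_defect W \<phi> (- j) = shift_defect W \<phi> j"
proof -
  have "(\<Sum>m\<in>W. \<phi> (m + j) * \<phi> m) = (\<Sum>m\<in>{m\<in>W. m + j \<in> W}. \<phi> (m + j) * \<phi> m)"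
    using W supp by (intro sum.mono_neutral_right) auto
  also have "\<dots> = (\<Sum>m\<in>{m\<in>W. m - j \<in> W}. \<phi> (m - j) * \<phi> m)"
    by (rule sum.reindex_bij_witness[of _ "\<lambda>m. m - j" "\<lambda>m. m + j"]) (auto simp: mult.commute)
  also have "\<dots> = (\<Sum>m\<in>W. \<phi> (m - j) * \<phi> m)"
    using W supp by (intro sum.mono_neutral_left) auto
  finally show ?thesis by (simp add: shift_defect_def)
qed

lemma shift_defect_le:
  fixes \<phi> :: "'g::ab_group_add \<Rightarrow> real"
  assumes W: "finite W" and supp: "\<forall>i. i \<notin> W \<longrightarrow> \<phi> i = 0"
  shows "shift_defect W \<phi> j \<le> 2 * sqrt (\<Sum>m\<in>W. (\<phi> m)\<^sup>2)"
proof -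
  have "0 \<le> (\<Sum>m\<in>W. (\<phi> (m - j) + \<phi> m)\<^sup>2)" by (intro sum_nonneg) auto
  also have "\<dots> = (\<Sum>m\<in>W. (\<phi> (m - j))\<^sup>2) + (\<Sum>m\<in>W. (\<phi> m)\<^sup>2) + 2 * (\<Sum>m\<in>W. \<phi> (m - j) * \<phi> m)"
    unfolding sum_distrib_left sum.distrib[symmetric]
    by (intro sum.cong refl) (simp add: power2_eq_square algebra_simps)
  also have "(\<Sum>m\<in>W. (\<phi> (m - j))\<^sup>2) = (\<Sum>m\<in>(\<lambda>m. m - j) ` W. (\<phi> m)\<^sup>2)"
    by (subst sum.reindex) (auto simp: inj_on_def)
  also have "\<dots> = (\<Sum>m\<in>(\<lambda>m. m - j) ` W \<inter> W. (\<phi> m)\<^sup>2)"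
    using W supp by (intro sum.mono_neutral_right) auto
  also have "\<dots> \<le> (\<Sum>m\<in>W. (\<phi> m)\<^sup>2)" using W by (intro sum_mono2) auto
  finally have "2 * ((\<Sum>m\<in>W. (\<phi> m)\<^sup>2) - (\<Sum>m\<in>W. \<phi> (m - j) * \<phi> m)) \<le> 2\<^sup>2 * (\<Sum>m\<in>W. (\<phi> m)\<^sup>2)"
    by simp
  then have "shift_defect W \<phi> j \<le> sqrt (2\<^sup>2 * (\<Sum>m\<in>W. (\<phi> m)\<^sup>2))"
    unfolding shift_defect_def by (rule real_sqrt_le_mono)
  then show ?thesis by (simp add: real_sqrt_mult)
qed

lemma has_sum_finite_sum:
  fixes f :: "'a \<Rightarrow> 'b \<Rightarrow> 'c::topological_comm_monoid_add"
  assumes "\<And>a. a \<in> F \<Longrightarrow> (f a has_sum s a) B"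
  shows "((\<lambda>b. \<Sum>a\<in>F. f a b) has_sum (\<Sum>a\<in>F. s a)) B"
  using assms by (induction F rule: infinite_finite_induct) (auto intro: has_sum_add)

text \<open>For each \<open>i\<close> the squares \<open>\<phi> (i - k) ^ 2\<close> of the translated weights have the same sum over \<open>k\<close>.
  Writing the norm of the \<open>k\<close>-th localisation as a finite sum over \<open>W\<close> reduces the double series to
  finitely many shifted copies of the series for \<open>norm y ^ 2\<close>.\<close>

lemma has_sum_norm_translated_weights:
  fixes \<phi> :: "'g::ab_group_add \<Rightarrow> real" and y :: "('g, 'y::complex_normed_space) ell2"
  assumes W: "finite W" and supp: "\<forall>i. i \<notin> W \<longrightarrow> \<phi> i = 0"
  shows "((\<lambda>k. (norm (cblinfun_apply (weight_op (\<lambda>i. \<phi> (i - k))) y))\<^sup>2)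
    has_sum (\<Sum>i\<in>W. (\<phi> i)\<^sup>2) * (norm y)\<^sup>2) UNIV"
proof -
  have "bounded (range (\<lambda>i. \<phi> (i - k)))" for k
    by (rule bounded_subset[OF bounded_range_finite_support[OF assms]]) auto
  note nth = weight_op_nth[OF this]
  have "(norm (cblinfun_apply (weight_op (\<lambda>i. \<phi> (i - k))) y))\<^sup>2
      = (\<Sum>w\<in>W. (\<phi> w)\<^sup>2 * (norm (ell2_nth y (w + k)))\<^sup>2)" for k
  proof -
    have "((\<lambda>i. (norm (\<phi> (i - k) *\<^sub>R ell2_nth y i))\<^sup>2) has_sum
        (\<Sum>i\<in>(\<lambda>w. w + k) ` W. (norm (\<phi> (i - k) *\<^sub>R ell2_nth y i))\<^sup>2)) UNIV"
    proof (rule has_sum_finite_neutralI)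
      fix i assume i: "i \<in> UNIV - (\<lambda>w. w + k) ` W"
      have "i - k \<notin> W"
      proof
        assume "i - k \<in> W"
        then have "i - k + k \<in> (\<lambda>w. w + k) ` W" by (rule imageI)
        then show False using i by simp
      qed
      then show "(norm (\<phi> (i - k) *\<^sub>R ell2_nth y i))\<^sup>2 = 0" using supp by simp
    qed (use W in auto)
    then have "(norm (cblinfun_apply (weight_op (\<lambda>i. \<phi> (i - k))) y))\<^sup>2
        = (\<Sum>i\<in>(\<lambda>w. w + k) ` W. (norm (\<phi> (i - k) *\<^sub>R ell2_nth y i))\<^sup>2)"
      unfolding norm_ell2_square nth by (rule infsumI)
    also have "\<dots> = (\<Sum>w\<in>W. (\<phi> w)\<^sup>2 * (norm (ell2_nth y (w + k)))\<^sup>2)"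
      by (subst sum.reindex) (auto simp: inj_on_def power_mult_distrib)
    finally show ?thesis .
  qed
  moreover have "((\<lambda>k. \<Sum>w\<in>W. (\<phi> w)\<^sup>2 * (norm (ell2_nth y (w + k)))\<^sup>2)
      has_sum (\<Sum>w\<in>W. (\<phi> w)\<^sup>2 * (norm y)\<^sup>2)) UNIV"
  proof (intro has_sum_finite_sum has_sum_cmult_right)
    fix w :: 'g
    have "bij_betw (\<lambda>k. w + k) UNIV UNIV"
      by (rule bij_betwI[where g = "\<lambda>k. k - w"]) (auto simp: algebra_simps)
    then show "((\<lambda>k. (norm (ell2_nth y (w + k)))\<^sup>2) has_sum (norm y)\<^sup>2) UNIV"
      using has_sum_reindex_bij_betw[of "\<lambda>k. w + k" UNIV UNIV "\<lambda>i. (norm (ell2_nth y i))\<^sup>2"]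
        ell2_has_sum_norm[of y] by simp
  qed
  ultimately show ?thesis by (simp add: sum_distrib_right)
qed

section \<open>Commutators with translated weights\<close>

text \<open>The one property of the operator that the localisation argument uses. It bounds the commutator
  with a bounded weight entrywise, as if the entry at \<open>(i, i - j)\<close> had norm at most \<open>\<beta> j\<close>. Operators
  in the Wiener algebra and their adjoints both have it.\<close>

definition commutator_dominated ::
  "('g::ab_group_add \<Rightarrow> real) \<Rightarrow>
   (('g, 'y::complex_normed_space) ell2, ('g, 'y) ell2) cblinfun \<Rightarrow> bool" where
  "commutator_dominated \<beta> B \<longleftrightarrow> (\<forall>\<psi> x i. bounded (range \<psi>) \<longrightarrow>
     norm (ell2_nth (cblinfun_apply B (cblinfun_apply (weight_op \<psi>) x)) i
           - \<psi> i *\<^sub>R ell2_nth (cblinfun_apply B x) i)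
     \<le> (\<Sum>\<^sub>\<infinity>j. \<beta> j * \<bar>\<psi> (i - j) - \<psi> i\<bar> * norm (ell2_nth x (i - j))))"

text \<open>The family of all commutators with the translated weights, regarded as a square summable family
  over the pairs \<open>(k, i)\<close>, is dominated by a sum over \<open>j\<close> of families \<open>T j\<close>. The Minkowski inequality
  bounds its norm by the sum of the norms of the \<open>T j\<close>. In the norm of a single \<open>T j\<close> the sum over \<open>k\<close>
  is at most the square of the shift defect for every \<open>i\<close>, and what is left is at most
  \<open>norm x ^ 2\<close>. Estimating each diagonal as a whole, rather than each row by the Cauchy-Schwarz
  inequality, keeps the bound linear in \<open>\<beta>\<close>, so that \<open>\<beta> j\<close> may later be averaged with
  \<open>\<beta> (- j)\<close>.\<close>

lemma commutator_sum_bound: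
  fixes \<phi> :: "'g::ab_group_add \<Rightarrow> real" and x :: "('g, 'y::complex_normed_space) ell2"
  assumes dom: "commutator_dominated \<beta> B" and \<beta>: "\<And>j. 0 \<le> \<beta> j" "\<beta> summable_on UNIV"
    and W: "finite W" and supp: "\<forall>i. i \<notin> W \<longrightarrow> \<phi> i = 0"
  defines "D \<equiv> \<lambda>k. cblinfun_apply B (cblinfun_apply (weight_op (\<lambda>i. \<phi> (i - k))) x)
      - cblinfun_apply (weight_op (\<lambda>i. \<phi> (i - k))) (cblinfun_apply B x)"
  shows "(\<lambda>k. (norm (D k))\<^sup>2) summable_on UNIV"
    and "sqrt (\<Sum>\<^sub>\<infinity>k. (norm (D k))\<^sup>2) \<le> (\<Sum>\<^sub>\<infinity>j. \<beta> j * shift_defect W \<phi> j) * norm x"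
proof -
  define C where "C = (\<Sum>\<^sub>\<infinity>j. \<beta> j * shift_defect W \<phi> j)"
  have d0: "0 \<le> shift_defect W \<phi> j" for j by (rule shift_defect_nonneg(1)[OF W supp])
  obtain K where K: "\<bar>\<phi> i\<bar> \<le> K" for i
    using bounded_range_finite_support[OF W supp] by (auto simp: bounded_iff)
  have K0: "0 \<le> K" using K[of 0] by linarith
  have bd: "bounded (range (\<lambda>i. \<phi> (i - k)))" for k
    using K unfolding bounded_iff by auto
  have sC: "(\<lambda>j. \<beta> j * shift_defect W \<phi> j) summable_on UNIV"
    by (rule summable_on_comparison_test[OF summable_on_cmult_left[OF \<beta>(2), of "2 * sqrt (\<Sum>m\<in>W. (\<phi> m)\<^sup>2)"]])
      (auto intro!: mult_left_mono mult_nonneg_nonneg \<beta> d0 shift_defect_le[OF W supp])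
  have C0: "0 \<le> C" unfolding C_def by (intro infsum_nonneg mult_nonneg_nonneg \<beta> d0)
  define T where "T j p = \<beta> j * \<bar>\<phi> (snd p - j - fst p) - \<phi> (snd p - fst p)\<bar> * norm (ell2_nth x (snd p - j))"
    for j and p :: "'g \<times> 'g"
  have T0: "0 \<le> T j p" for j p by (simp add: T_def \<beta>)
  have Ts: "(\<lambda>j. T j p) summable_on UNIV" for p
  proof (rule summable_on_comparison_test[OF summable_on_cmult_left[OF \<beta>(2), of "2 * K * norm x"]])
    fix j
    have "\<bar>\<phi> (snd p - j - fst p) - \<phi> (snd p - fst p)\<bar> \<le> 2 * K"
      using K[of "snd p - j - fst p"] K[of "snd p - fst p"] by linarith
    then show "T j p \<le> \<beta> j * (2 * K * norm x)"
      unfolding T_def mult.assoc using K0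
      by (intro mult_left_mono mult_mono[of _ "2 * K", unfolded mult.assoc] norm_ell2_nth_le \<beta>) auto
  qed (rule T0)
  have nD: "norm (ell2_nth (D k) i) \<le> (\<Sum>\<^sub>\<infinity>j. T j (k, i))" for k i
    using dom[unfolded commutator_dominated_def, rule_format, OF bd[of k], of x i]
    by (simp add: D_def T_def minus_ell2.rep_eq weight_op_nth[OF bd])
  \<comment> \<open>On finite rectangles of pairs the Minkowski inequality is available; the series over \<open>j\<close> and
    the series over \<open>i\<close> and \<open>k\<close> are then exhausted by finite sums.\<close>
  have one: "L2_set (T j) (F \<times> I) \<le> \<beta> j * shift_defect W \<phi> j * norm x"
    if F: "finite F" and I: "finite I" for j F I
  proof -
    have "(\<Sum>p\<in>F \<times> I. (T j p)\<^sup>2)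
        = (\<Sum>i\<in>I. (\<beta> j)\<^sup>2 * (norm (ell2_nth x (i - j)))\<^sup>2 * (\<Sum>k\<in>F. (\<phi> (i - j - k) - \<phi> (i - k))\<^sup>2))"
      unfolding sum.cartesian_product' sum.swap[of _ I F] sum_distrib_left
      by (intro sum.cong refl) (simp add: T_def power_mult_distrib mult_ac)
    also have "\<dots> \<le> (\<Sum>i\<in>I. (\<beta> j)\<^sup>2 * (norm (ell2_nth x (i - j)))\<^sup>2 * (shift_defect W \<phi> j)\<^sup>2)"
    proof (intro sum_mono mult_left_mono)
      fix i
      have "(\<Sum>k\<in>F. (\<phi> (i - j - k) - \<phi> (i - k))\<^sup>2) = (\<Sum>m\<in>(\<lambda>k. i - k) ` F. (\<phi> (m - j) - \<phi> m)\<^sup>2)"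
        by (subst sum.reindex) (auto simp: inj_on_def algebra_simps)
      also have "\<dots> \<le> (shift_defect W \<phi> j)\<^sup>2"
        unfolding shift_defect_nonneg(2)[OF W supp]
        by (rule sum_shift_difference_le[OF W supp]) (use F in auto)
      finally show "(\<Sum>k\<in>F. (\<phi> (i - j - k) - \<phi> (i - k))\<^sup>2) \<le> (shift_defect W \<phi> j)\<^sup>2" .
    qed auto
    also have "\<dots> = (\<beta> j * shift_defect W \<phi> j)\<^sup>2 * (\<Sum>i\<in>(\<lambda>i. i - j) ` I. (norm (ell2_nth x i))\<^sup>2)"
      by (subst sum.reindex) (auto simp: inj_on_def sum_distrib_left power_mult_distrib mult_ac)
    also have "\<dots> \<le> (\<beta> j * shift_defect W \<phi> j)\<^sup>2 * (norm x)\<^sup>2"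
      using I by (intro mult_left_mono finite_sum_le_has_sum[OF ell2_has_sum_norm]) auto
    finally show ?thesis
      unfolding L2_set_def using \<beta> d0
      by (intro real_le_lsqrt) (auto simp: power_mult_distrib intro: sum_nonneg)
  qed
  have partial: "L2_set (\<lambda>p. \<Sum>j\<in>J. T j p) P \<le> (\<Sum>j\<in>J. L2_set (T j) P)" if "finite J" for J P
    using that
  proof (induction J)
    case (insert j J)
    have "L2_set (\<lambda>p. \<Sum>j\<in>insert j J. T j p) P = L2_set (\<lambda>p. T j p + (\<Sum>j\<in>J. T j p)) P"
      using insert by simp
    also have "\<dots> \<le> L2_set (T j) P + L2_set (\<lambda>p. \<Sum>j\<in>J. T j p) P"
      by (rule L2_set_triangle_ineq)
    finally show ?case using insert by simp
  qed (simp add: L2_set_def)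
  have rect: "L2_set (\<lambda>p. \<Sum>\<^sub>\<infinity>j. T j p) (F \<times> I) \<le> C * norm x"
    if F: "finite F" and I: "finite I" for F I
  proof (rule tendsto_upperbound)
    show "((\<lambda>J. L2_set (\<lambda>p. \<Sum>j\<in>J. T j p) (F \<times> I)) \<longlongrightarrow> L2_set (\<lambda>p. \<Sum>\<^sub>\<infinity>j. T j p) (F \<times> I))
        (finite_subsets_at_top UNIV)"
      unfolding L2_set_def by (intro tendsto_intros infsum_tendsto Ts)
    have "L2_set (\<lambda>p. \<Sum>j\<in>J. T j p) (F \<times> I) \<le> C * norm x" if "finite J" for J
    proof -
      have "L2_set (\<lambda>p. \<Sum>j\<in>J. T j p) (F \<times> I) \<le> (\<Sum>j\<in>J. \<beta> j * shift_defect W \<phi> j * norm x)"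
        by (intro order_trans[OF partial[OF that]] sum_mono one F I)
      also have "\<dots> \<le> C * norm x"
        unfolding sum_distrib_right[symmetric] C_def
        by (intro mult_right_mono finite_sum_le_infsum sC that) (auto intro: mult_nonneg_nonneg \<beta> d0)
      finally show ?thesis .
    qed
    then show "\<forall>\<^sub>F J in finite_subsets_at_top UNIV. L2_set (\<lambda>p. \<Sum>j\<in>J. T j p) (F \<times> I) \<le> C * norm x"
      by (intro eventually_finite_subsets_at_top_weakI) auto
  qed simp
  have fin: "L2_set (\<lambda>k. norm (D k)) F \<le> C * norm x" if F: "finite F" for F
  proof -
    have "((\<lambda>i. \<Sum>k\<in>F. (norm (ell2_nth (D k) i))\<^sup>2) has_sum (\<Sum>k\<in>F. (norm (D k))\<^sup>2)) UNIV"
      by (intro has_sum_finite_sum ell2_has_sum_norm)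
    moreover have "(\<Sum>i\<in>I. \<Sum>k\<in>F. (norm (ell2_nth (D k) i))\<^sup>2) \<le> (C * norm x)\<^sup>2" if I: "finite I" for I
    proof -
      have "(\<Sum>i\<in>I. \<Sum>k\<in>F. (norm (ell2_nth (D k) i))\<^sup>2) \<le> (\<Sum>i\<in>I. \<Sum>k\<in>F. (\<Sum>\<^sub>\<infinity>j. T j (k, i))\<^sup>2)"
        by (intro sum_mono power_mono nD) auto
      also have "\<dots> = (L2_set (\<lambda>p. \<Sum>\<^sub>\<infinity>j. T j p) (F \<times> I))\<^sup>2"
        by (simp add: L2_set_def sum_nonneg sum.cartesian_product' sum.swap[of _ I F])
      also have "\<dots> \<le> (C * norm x)\<^sup>2"
        by (intro power_mono rect F I L2_set_nonneg)
      finally show ?thesis .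
    qed
    ultimately have "(\<Sum>k\<in>F. (norm (D k))\<^sup>2) \<le> (C * norm x)\<^sup>2"
      by (rule has_sum_le_finite_sums) blast
    then show ?thesis
      unfolding L2_set_def using C0 by (intro real_le_lsqrt) (auto intro: sum_nonneg)
  qed
  show "(\<lambda>k. (norm (D k))\<^sup>2) summable_on UNIV" by (rule ell2_boundI(1)[OF fin])
  show "sqrt (\<Sum>\<^sub>\<infinity>k. (norm (D k))\<^sup>2) \<le> (\<Sum>\<^sub>\<infinity>j. \<beta> j * shift_defect W \<phi> j) * norm x"
    using ell2_boundI(2)[OF fin] unfolding C_def .
qed

section \<open>Truncation to windows\<close>

lemma lower_norm_le:
  assumes "x \<in> S" "norm x = 1"
  shows "lower_norm S B \<le> ereal (norm (cblinfun_apply B x))"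
  unfolding lower_norm_def by (rule INF_lower) (use assms in auto)

lemma lower_norm_scale:
  fixes B :: "('a::complex_normed_space, 'b::complex_normed_space) cblinfun"
  assumes low: "ereal t \<le> lower_norm S B" and x: "x \<in> S" and S: "\<And>r u. u \<in> S \<Longrightarrow> r *\<^sub>R u \<in> S"
  shows "t * norm x \<le> norm (cblinfun_apply B x)"
proof (cases "x = 0")
  case False
  let ?u = "(1 / norm x) *\<^sub>R x"
  have "norm ?u = 1" using False by simp
  then have "ereal t \<le> ereal (norm (cblinfun_apply B ?u))"
    using lower_norm_le[OF S[OF x, of "1 / norm x"], of B] order_trans[OF low] by blast
  then have "t \<le> norm (cblinfun_apply B x) / norm x"
    by (simp add: cblinfun_apply_scaleR)
  then show ?thesis using False by (simp add: field_simps)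
qed simp

text \<open>On sequences supported in the window the cutoff is invisible, so a patch of \<open>B - z\<close> is the
  restriction of \<open>B - z\<close>. All comparisons with the pseudospectra of \<open>B\<close> rest on this.\<close>

lemma patch_lower_norm_eq:
  "patch_lower_norm W B z k = lower_norm (ell2_on (window W k)) (B - z *\<^sub>C cblinfun_id)"
proof -
  have "cblinfun_apply (cutoff_op (window W k)) x = x" if "x \<in> ell2_on (window W k)"
    for x :: "('a, 'b) ell2"
    using that by (intro ell2_eqI) (simp add: cutoff_op_nth ell2_on_def)
  then show ?thesis
    unfolding patch_lower_norm_def lower_norm_def patch_def
    by (intro INF_cong) (auto simp: cblinfun_apply_minus_apply cblinfun_compose.rep_eq)
qed

text \<open>Let \<open>m k\<close> be multiplication by the weight translated to the window at \<open>k\<close>, and \<open>D k\<close> its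
  commutator with \<open>B\<close> applied to \<open>x\<close>, so that \<open>(B - z) (m k x) = m k ((B - z) x) + D k\<close>. If the
  lower norms on all windows are at least \<open>t\<close>, the left-hand side has norm at least
  \<open>t * norm (m k x)\<close>. Taking square sums over \<open>k\<close>, where
  \<open>\<Sum>k. norm (m k y) ^ 2 = norm y ^ 2\<close>, and using the triangle inequality in the space of square
  summable families yields \<open>t \<le> norm ((B - z) x) + C\<close> with the commutator bound \<open>C\<close>. So a global
  near-minimiser \<open>x\<close> has a localised near-minimiser \<open>m k x\<close> on some window.\<close>

lemma window_lower_norm_le:
  fixes B :: "(('g::ab_group_add, 'y::complex_normed_space) ell2, ('g, 'y) ell2) cblinfun"
  assumes dom: "commutator_dominated \<beta> B" and \<beta>: "\<And>j. 0 \<le> \<beta> j" "\<beta> summable_on UNIV"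
    and W: "finite W" and supp: "\<forall>i. i \<notin> W \<longrightarrow> \<phi> i = 0" and unit: "(\<Sum>i\<in>W. (\<phi> i)\<^sup>2) = 1"
  shows "(INF k. lower_norm (ell2_on (window W k)) (B - z *\<^sub>C cblinfun_id))
    \<le> lower_norm UNIV (B - z *\<^sub>C cblinfun_id) + ereal (\<Sum>\<^sub>\<infinity>j. \<beta> j * shift_defect W \<phi> j)"
proof -
  define I where "I = (INF k. lower_norm (ell2_on (window W k)) (B - z *\<^sub>C cblinfun_id))"
  define C where "C = (\<Sum>\<^sub>\<infinity>j. \<beta> j * shift_defect W \<phi> j)"
  have C0: "0 \<le> C"
    unfolding C_def by (intro infsum_nonneg mult_nonneg_nonneg \<beta> shift_defect_nonneg(1)[OF W supp])
  have bd: "bounded (range (\<lambda>i. \<phi> (i - k)))" for k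
    by (rule bounded_subset[OF bounded_range_finite_support[OF W supp]]) auto
  note nth = weight_op_nth[OF bd]
  have key: "I \<le> ereal (norm (cblinfun_apply (B - z *\<^sub>C cblinfun_id) x) + C)" if x: "norm x = 1" for x
  proof (rule ccontr)
    assume "\<not> ?thesis"
    then obtain t where t: "norm (cblinfun_apply (B - z *\<^sub>C cblinfun_id) x) + C < t" "ereal t \<le> I"
      by (metis ereal_dense2 less_ereal.simps(1) less_imp_le not_le)
    define m where "m k y = cblinfun_apply (weight_op (\<lambda>i. \<phi> (i - k))) y"
      for k and y :: "('g, 'y) ell2"
    define y where "y = cblinfun_apply (B - z *\<^sub>C cblinfun_id) x"
    define D where "D k = cblinfun_apply B (m k x) - m k (cblinfun_apply B x)" for k
    have t0: "0 \<le> t" using t(1) C0 norm_ge_zero[of "cblinfun_apply (B - z *\<^sub>C cblinfun_id) x"] by linarith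
    have hm: "((\<lambda>k. (norm (m k u))\<^sup>2) has_sum (norm u)\<^sup>2) UNIV" for u
      using has_sum_norm_translated_weights[OF W supp, of u] by (simp add: m_def unit)
    have split: "cblinfun_apply (B - z *\<^sub>C cblinfun_id) (m k x) = m k y + D k" for k
      by (simp add: D_def y_def m_def cblinfun_apply_minus_apply scaleC_cblinfun_id_apply
          cblinfun_apply_diff cblinfun_apply_scaleC)
    have sD: "(\<lambda>k. (norm (D k))\<^sup>2) summable_on UNIV" "sqrt (\<Sum>\<^sub>\<infinity>k. (norm (D k))\<^sup>2) \<le> C"
      using commutator_sum_bound[OF dom \<beta> W supp, of x] x by (simp_all add: D_def m_def C_def)
    have low: "t * norm (m k x) \<le> norm (m k y + D k)" for k
      unfolding split[symmetric]
    proof (rule lower_norm_scale)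
      show "ereal t \<le> lower_norm (ell2_on (window W k)) (B - z *\<^sub>C cblinfun_id)"
        using t(2) unfolding I_def by (rule order_trans) (rule INF_lower, simp)
      have "i - k \<notin> W" if "i \<notin> window W k" for i
      proof
        assume "i - k \<in> W"
        then have "k + (i - k) \<in> window W k" unfolding window_def by (rule imageI)
        then show False using that by simp
      qed
      then show "m k x \<in> ell2_on (window W k)" using supp by (auto simp: ell2_on_def m_def nth)
      show "r *\<^sub>R u \<in> ell2_on (window W k)" if "u \<in> ell2_on (window W k)" for r and u :: "('g, 'y) ell2"
        using that by (auto simp: ell2_on_def scaleR_ell2.rep_eq)
    qed
    note tri = ell2_triangle[OF has_sum_imp_summable[OF hm[of y]] sD(1)]
    have "((\<lambda>k. t\<^sup>2 * (norm (m k x))\<^sup>2) has_sum t\<^sup>2 * (norm x)\<^sup>2) UNIV"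
      by (intro has_sum_cmult_right hm)
    then have "((\<lambda>k. (t * norm (m k x))\<^sup>2) has_sum t\<^sup>2) UNIV"
      by (simp add: power_mult_distrib x)
    from has_sum_mono[OF this has_sum_infsum[OF tri(1)]]
    have "t\<^sup>2 \<le> (\<Sum>\<^sub>\<infinity>k. (norm (m k y + D k))\<^sup>2)"
      using low t0 by (auto intro!: power_mono)
    then have "t \<le> sqrt (\<Sum>\<^sub>\<infinity>k. (norm (m k y + D k))\<^sup>2)" by (rule real_le_rsqrt)
    also have "\<dots> \<le> sqrt (\<Sum>\<^sub>\<infinity>k. (norm (m k y))\<^sup>2) + sqrt (\<Sum>\<^sub>\<infinity>k. (norm (D k))\<^sup>2)" by (rule tri(2))
    also have "\<dots> \<le> norm y + C" using sD(2) infsumI[OF hm[of y]] by simp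
    finally show False using t(1) by (simp add: y_def)
  qed
  have "I - ereal C \<le> lower_norm UNIV (B - z *\<^sub>C cblinfun_id)"
    unfolding lower_norm_def
    by (intro INF_greatest) (use key in \<open>auto simp: ereal_minus_le_iff add.commute\<close>)
  then show ?thesis unfolding I_def[symmetric] C_def[symmetric] by (simp add: ereal_minus_le_iff add.commute)
qed

section \<open>Operators in the Wiener algebra and their adjoints\<close>

lemma norm_le_sup_norm:
  assumes "bounded (range c)"
  shows "norm (c i) \<le> sup_norm c"
proof -
  obtain K where "norm (c i) \<le> K" for i using assms by (auto simp: bounded_iff)
  then have "bdd_above (range (\<lambda>i. norm (c i)))" by (intro bdd_aboveI[of _ K]) auto
  then show ?thesis unfolding sup_norm_def by (rule cSUP_upper[OF UNIV_I])
qed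

lemma sup_norm_nonneg: "bounded (range c) \<Longrightarrow> 0 \<le> sup_norm c"
  using norm_le_sup_norm[of c undefined] norm_ge_zero order_trans by blast

lemma has_sum_diff:
  fixes f g :: "'a \<Rightarrow> 'b::real_normed_vector"
  assumes "(f has_sum a) S" "(g has_sum c) S"
  shows "((\<lambda>x. f x - g x) has_sum a - c) S"
  using has_sum_add[OF assms(1), of "\<lambda>x. - g x" "- c"] assms(2) by (simp add: has_sum_uminus)

lemma wiener_rep_has_sum:
  fixes A :: "(('g::ab_group_add, 'y::complex_normed_space) ell2, ('g, 'y) ell2) cblinfun"
  assumes "wiener_rep b A"
  shows "((\<lambda>j. cblinfun_apply (b j i) (ell2_nth x (i - j))) has_sum ell2_nth (cblinfun_apply A x) i) UNIV"
proof -
  have b: "bounded (range (b j))" for j using assms by (simp add: wiener_rep_def)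
  have "bounded_linear (\<lambda>B :: (('g, 'y) ell2, ('g, 'y) ell2) cblinfun. ell2_nth (cblinfun_apply B x) i)"
  proof (rule bounded_linear_intro[where K = "norm x"])
    fix B :: "(('g, 'y) ell2, ('g, 'y) ell2) cblinfun"
    show "norm (ell2_nth (cblinfun_apply B x) i) \<le> norm B * norm x"
      using norm_ell2_nth_le[of "cblinfun_apply B x" i] norm_cblinfun[of B x] by linarith
  qed (simp_all add: plus_cblinfun.rep_eq plus_ell2.rep_eq scaleR_cblinfun.rep_eq scaleR_ell2.rep_eq)
  from has_sum_bounded_linear[OF this, of "\<lambda>j. mult_op (b j) o\<^sub>C shift_op j" UNIV A]
  show ?thesis
    using assms by (simp add: wiener_rep_def o_def cblinfun_compose.rep_eq mult_op_nth[OF b] shift_op_nth)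
qed

text \<open>The coefficients are the entries of the operator matrix. In particular they are determined by
  the operator, so that the summability in \<open>wiener_class\<close> is a property of every representation.\<close>

lemma wiener_rep_single:
  assumes "wiener_rep b A"
  shows "ell2_nth (cblinfun_apply A (ell2_single l y)) i = cblinfun_apply (b (i - l) i) y"
proof -
  have "((\<lambda>j. cblinfun_apply (b j i) (ell2_nth (ell2_single l y) (i - j))) has_sum
      cblinfun_apply (b (i - l) i) y) UNIV"
    by (rule has_sum_finite_neutralI[of "{i - l}"]) (auto simp: ell2_single.rep_eq algebra_simps)
  then show ?thesis using wiener_rep_has_sum[OF assms] has_sum_unique by blast
qed

lemma wiener_rep_unique:
  assumes "wiener_rep b A" "wiener_rep b' A"
  shows "b = b'"
proof -
  have "cblinfun_apply (b j i) y = cblinfun_apply (b' j i) y" for j i y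
    using wiener_rep_single[OF assms(1), of "i - j" y i] wiener_rep_single[OF assms(2), of "i - j" y i]
    by simp
  then show ?thesis by (simp add: cblinfun_apply_inject[symmetric] fun_eq_iff)
qed

text \<open>In the series for the commutator, the diagonal \<open>j\<close> contributes
  \<open>b j i ((\<psi> (i - j) - \<psi> i) x (i - j))\<close>.\<close>

lemma commutator_dominated_wiener:
  assumes b: "wiener_rep b A"
  shows "commutator_dominated (\<lambda>j. sup_norm (b j)) A"
  unfolding commutator_dominated_def
proof (intro allI impI)
  fix \<psi> :: "'a \<Rightarrow> real" and x i assume bd: "bounded (range \<psi>)"
  then obtain K where K: "\<bar>\<psi> i\<bar> \<le> K" for i by (auto simp: bounded_iff)
  have bb: "bounded (range (b j))" for j using b by (simp add: wiener_rep_def)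
  have "((\<lambda>j. cblinfun_apply (b j i) (\<psi> (i - j) *\<^sub>R ell2_nth x (i - j))
        - \<psi> i *\<^sub>R cblinfun_apply (b j i) (ell2_nth x (i - j))) has_sum
      ell2_nth (cblinfun_apply A (cblinfun_apply (weight_op \<psi>) x)) i
        - \<psi> i *\<^sub>R ell2_nth (cblinfun_apply A x) i) UNIV"
    using wiener_rep_has_sum[OF b, of i "cblinfun_apply (weight_op \<psi>) x"]
      has_sum_scaleR[OF wiener_rep_has_sum[OF b, of i x], of "\<psi> i"]
    by (intro has_sum_diff) (simp_all add: weight_op_nth[OF bd])
  moreover have "(\<lambda>j. sup_norm (b j) * \<bar>\<psi> (i - j) - \<psi> i\<bar> * norm (ell2_nth x (i - j))) summable_on UNIV"
  proof (rule summable_on_comparison_test)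
    show "(\<lambda>j. sup_norm (b j) * (2 * K * norm x)) summable_on UNIV"
      using b by (intro summable_on_cmult_left) (simp add: wiener_rep_def)
    fix j
    have "\<bar>\<psi> (i - j) - \<psi> i\<bar> \<le> 2 * K" using K[of "i - j"] K[of i] by linarith
    then show "sup_norm (b j) * \<bar>\<psi> (i - j) - \<psi> i\<bar> * norm (ell2_nth x (i - j)) \<le> sup_norm (b j) * (2 * K * norm x)"
      unfolding mult.assoc
      by (intro mult_left_mono mult_mono[of _ "2 * K", unfolded mult.assoc] norm_ell2_nth_le sup_norm_nonneg bb)
        auto
  qed (intro mult_nonneg_nonneg sup_norm_nonneg bb, auto)
  ultimately show "norm (ell2_nth (cblinfun_apply A (cblinfun_apply (weight_op \<psi>) x)) i
        - \<psi> i *\<^sub>R ell2_nth (cblinfun_apply A x) i)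
      \<le> (\<Sum>\<^sub>\<infinity>j. sup_norm (b j) * \<bar>\<psi> (i - j) - \<psi> i\<bar> * norm (ell2_nth x (i - j)))"
  proof (rule norm_infsum_le[OF _ has_sum_infsum])
    fix j
    have "norm (cblinfun_apply (b j i) (\<psi> (i - j) *\<^sub>R ell2_nth x (i - j))
        - \<psi> i *\<^sub>R cblinfun_apply (b j i) (ell2_nth x (i - j)))
      = \<bar>\<psi> (i - j) - \<psi> i\<bar> * norm (cblinfun_apply (b j i) (ell2_nth x (i - j)))"
      by (simp add: cblinfun_apply_scaleR flip: scaleR_left_diff_distrib)
    also have "\<dots> \<le> \<bar>\<psi> (i - j) - \<psi> i\<bar> * (sup_norm (b j) * norm (ell2_nth x (i - j)))"
      by (intro mult_left_mono order_trans[OF norm_cblinfun] mult_right_mono norm_le_sup_norm bb) auto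
    finally show "norm (cblinfun_apply (b j i) (\<psi> (i - j) *\<^sub>R ell2_nth x (i - j))
        - \<psi> i *\<^sub>R cblinfun_apply (b j i) (ell2_nth x (i - j)))
      \<le> sup_norm (b j) * \<bar>\<psi> (i - j) - \<psi> i\<bar> * norm (ell2_nth x (i - j))"
      by (simp add: mult_ac)
  qed
qed

lemma adj_op_nth:
  "cblinfun_apply (ell2_nth (cblinfun_apply (adj_op A) f) i) y
    = (\<Sum>\<^sub>\<infinity>k. cblinfun_apply (ell2_nth f k) (ell2_nth (cblinfun_apply A (ell2_single i y)) k))"
  by (subst pairing_single[symmetric]) (simp only: pairing_adj_op, simp only: pairing_def)

lemma adj_op_eqI:
  assumes "\<And>f x. pairing (cblinfun_apply B f) x = pairing f (cblinfun_apply A x)"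
  shows "adj_op A = B"
  using adj_op_ex1[of A] pairing_adj_op[of A] assms by blast

text \<open>The adjoint is a transpose without conjugation, so \<open>z\<close> stays as it is.\<close>

lemma adj_op_minus_scaleC_id:
  "adj_op (A - z *\<^sub>C cblinfun_id) = adj_op A - z *\<^sub>C cblinfun_id"
proof (rule adj_op_eqI)
  fix f x
  have dl: "pairing (g - h) u = pairing g u - pairing h u" for g h u
    using pairing_linear(1)[of "g - h" h u] by simp
  have dr: "pairing g (u - v) = pairing g u - pairing g v" for g u v
    using pairing_linear(3)[of g "u - v" v] by simp
  show "pairing (cblinfun_apply (adj_op A - z *\<^sub>C cblinfun_id) f) x
      = pairing f (cblinfun_apply (A - z *\<^sub>C cblinfun_id) x)"
    by (simp add: cblinfun_apply_minus_apply scaleC_cblinfun_id_apply dl dr pairing_linear pairing_adj_op)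
qed

text \<open>The entry of the adjoint at \<open>(i, k)\<close> is the transpose of the entry of \<open>A\<close> at \<open>(k, i)\<close>, which lies
  on the diagonal \<open>k - i\<close>; hence the reflection of the index. The estimate is carried out after
  applying the functionals to a vector \<open>y\<close>: this involves only series of complex numbers and avoids
  a Wiener representation of the adjoint.\<close>

lemma commutator_dominated_adj:
  fixes A :: "(('g::ab_group_add, 'y::complex_normed_space) ell2, ('g, 'y) ell2) cblinfun"
  assumes b: "wiener_rep b A"
  shows "commutator_dominated (\<lambda>j. sup_norm (b (- j))) (adj_op A)"
  unfolding commutator_dominated_def
proof (intro allI impI)
  fix \<psi> :: "'g \<Rightarrow> real" and f :: "('g, 'y dual) ell2" and i :: 'g
  assume bd: "bounded (range \<psi>)"
  then obtain K where K: "\<bar>\<psi> i\<bar> \<le> K" for i by (auto simp: bounded_iff)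
  have bb: "bounded (range (b j))" for j using b by (simp add: wiener_rep_def)
  let ?\<beta> = "\<lambda>j. sup_norm (b (- j))"
  let ?R = "\<Sum>\<^sub>\<infinity>j. ?\<beta> j * \<bar>\<psi> (i - j) - \<psi> i\<bar> * norm (ell2_nth f (i - j))"
  have bij: "bij_betw (\<lambda>k. i - k) UNIV UNIV"
    by (rule bij_betwI[where g = "\<lambda>k. i - k"]) auto
  have "(\<lambda>j. ?\<beta> j * \<bar>\<psi> (i - j) - \<psi> i\<bar> * norm (ell2_nth f (i - j))) summable_on UNIV"
  proof (rule summable_on_comparison_test)
    have "(\<lambda>j. sup_norm (b j)) summable_on UNIV" using b by (simp add: wiener_rep_def)
    then have "?\<beta> summable_on UNIV"
      using summable_on_reindex_bij_betw[of uminus UNIV UNIV "\<lambda>j. sup_norm (b j)"] by (simp add: bij_uminus)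
    then show "(\<lambda>j. ?\<beta> j * (2 * K * norm f)) summable_on UNIV"
      by (rule summable_on_cmult_left)
    fix j
    have "\<bar>\<psi> (i - j) - \<psi> i\<bar> \<le> 2 * K" using K[of "i - j"] K[of i] by linarith
    then show "?\<beta> j * \<bar>\<psi> (i - j) - \<psi> i\<bar> * norm (ell2_nth f (i - j)) \<le> ?\<beta> j * (2 * K * norm f)"
      unfolding mult.assoc
      by (intro mult_left_mono mult_mono[of _ "2 * K", unfolded mult.assoc] norm_ell2_nth_le sup_norm_nonneg bb)
        auto
  qed (intro mult_nonneg_nonneg sup_norm_nonneg bb, auto)
  then have "((\<lambda>j. ?\<beta> j * \<bar>\<psi> (i - j) - \<psi> i\<bar> * norm (ell2_nth f (i - j))) has_sum ?R) UNIV"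
    by (rule has_sum_infsum)
  then have R: "((\<lambda>k. sup_norm (b (k - i)) * \<bar>\<psi> k - \<psi> i\<bar> * norm (ell2_nth f k)) has_sum ?R) UNIV"
    by (subst has_sum_reindex_bij_betw[OF bij, symmetric]) simp
  have R0: "0 \<le> ?R" by (intro infsum_nonneg mult_nonneg_nonneg sup_norm_nonneg bb) auto
  show "norm (ell2_nth (cblinfun_apply (adj_op A) (cblinfun_apply (weight_op \<psi>) f)) i
        - \<psi> i *\<^sub>R ell2_nth (cblinfun_apply (adj_op A) f) i) \<le> ?R"
  proof (rule norm_cblinfun_bound[OF R0])
    fix y
    let ?a = "\<lambda>k. ell2_nth (cblinfun_apply A (ell2_single i y)) k"
    have 1: "((\<lambda>k. cblinfun_apply (ell2_nth f k) (?a k)) has_sum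
        cblinfun_apply (ell2_nth (cblinfun_apply (adj_op A) f) i) y) UNIV" for f
      unfolding adj_op_nth by (rule has_sum_infsum[OF pairing_summable])
    have "((\<lambda>k. \<psi> k *\<^sub>R cblinfun_apply (ell2_nth f k) (?a k) - \<psi> i *\<^sub>R cblinfun_apply (ell2_nth f k) (?a k))
      has_sum cblinfun_apply (ell2_nth (cblinfun_apply (adj_op A) (cblinfun_apply (weight_op \<psi>) f)) i
        - \<psi> i *\<^sub>R ell2_nth (cblinfun_apply (adj_op A) f) i) y) UNIV"
      using 1[of "cblinfun_apply (weight_op \<psi>) f"] has_sum_scaleR[OF 1[of f], of "\<psi> i"]
      unfolding cblinfun_apply_minus_apply scaleR_cblinfun.rep_eq
      by (intro has_sum_diff) (simp_all add: weight_op_nth[OF bd] scaleR_cblinfun.rep_eq)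
    moreover have "((\<lambda>k. sup_norm (b (k - i)) * \<bar>\<psi> k - \<psi> i\<bar> * norm (ell2_nth f k) * norm y)
        has_sum ?R * norm y) UNIV"
      by (rule has_sum_cmult_left[OF R])
    ultimately show "norm (cblinfun_apply (ell2_nth (cblinfun_apply (adj_op A) (cblinfun_apply (weight_op \<psi>) f)) i
        - \<psi> i *\<^sub>R ell2_nth (cblinfun_apply (adj_op A) f) i) y) \<le> ?R * norm y"
    proof (rule norm_infsum_le)
      fix k
      have "norm (\<psi> k *\<^sub>R cblinfun_apply (ell2_nth f k) (?a k) - \<psi> i *\<^sub>R cblinfun_apply (ell2_nth f k) (?a k))
          = \<bar>\<psi> k - \<psi> i\<bar> * norm (cblinfun_apply (ell2_nth f k) (?a k))"
        by (simp flip: scaleR_left_diff_distrib)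
      also have "\<dots> \<le> \<bar>\<psi> k - \<psi> i\<bar> * (norm (ell2_nth f k) * (sup_norm (b (k - i)) * norm y))"
        unfolding wiener_rep_single[OF b]
        by (intro mult_left_mono order_trans[OF norm_cblinfun] mult_right_mono norm_le_sup_norm bb) auto
      finally show "norm (\<psi> k *\<^sub>R cblinfun_apply (ell2_nth f k) (?a k) - \<psi> i *\<^sub>R cblinfun_apply (ell2_nth f k) (?a k))
          \<le> sup_norm (b (k - i)) * \<bar>\<psi> k - \<psi> i\<bar> * norm (ell2_nth f k) * norm y"
        by (simp add: mult_ac)
    qed
  qed
qed

section \<open>The truncation error\<close>

lemma infsum_cauchy_schwarz:
  fixes f g :: "'a \<Rightarrow> real"
  assumes f: "(\<lambda>j. (f j)\<^sup>2) summable_on S" and g: "(\<lambda>j. (g j)\<^sup>2) summable_on S"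
    and fg: "(\<lambda>j. f j * g j) summable_on S"
  shows "(\<Sum>\<^sub>\<infinity>j\<in>S. f j * g j) \<le> sqrt (\<Sum>\<^sub>\<infinity>j\<in>S. (f j)\<^sup>2) * sqrt (\<Sum>\<^sub>\<infinity>j\<in>S. (g j)\<^sup>2)"
proof (rule infsum_le_finite_sums[OF fg])
  fix F assume F: "finite F" "F \<subseteq> S"
  have "(\<Sum>j\<in>F. f j * g j) \<le> (\<Sum>j\<in>F. \<bar>f j\<bar> * \<bar>g j\<bar>)"
    by (intro sum_mono) (metis abs_ge_self abs_mult)
  also have "\<dots> \<le> L2_set f F * L2_set g F" by (rule L2_set_mult_ineq)
  also have "\<dots> \<le> sqrt (\<Sum>\<^sub>\<infinity>j\<in>S. (f j)\<^sup>2) * sqrt (\<Sum>\<^sub>\<infinity>j\<in>S. (g j)\<^sup>2)"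
    unfolding L2_set_def
    by (intro mult_mono real_sqrt_le_mono finite_sum_le_infsum f g F) (auto intro: sum_nonneg infsum_nonneg)
  finally show "(\<Sum>j\<in>F. f j * g j) \<le> sqrt (\<Sum>\<^sub>\<infinity>j\<in>S. (f j)\<^sup>2) * sqrt (\<Sum>\<^sub>\<infinity>j\<in>S. (g j)\<^sup>2)" .
qed

lemma has_sum_drop_zero:
  assumes "(f has_sum s) UNIV" "f 0 = 0"
  shows "(f has_sum s) (-{0})"
  using assms(1) by (rule has_sum_cong_neutral[THEN iffD1, rotated 3]) (use assms(2) in auto)

lemma has_sum_reflect:
  fixes f :: "'g::ab_group_add \<Rightarrow> 'b::{comm_monoid_add, topological_space}"
  shows "((\<lambda>l. f (k - l)) has_sum s) UNIV \<longleftrightarrow> (f has_sum s) UNIV"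
  by (rule has_sum_reindex_bij_betw, rule bij_betwI[where g = "\<lambda>l. k - l"]) auto

text \<open>The Dirichlet form of the Laplacian at \<open>\<phi>\<close> is a sum over the edges \<open>(k, k - j)\<close>. Grouping them by
  their direction \<open>j\<close> turns it into a series over \<open>j\<close>, in which \<open>\<omega> j\<close> multiplies the squared
  distance between \<open>\<phi>\<close> and its translate by \<open>j\<close>. The edges that leave \<open>W\<close> fit in because \<open>\<phi>\<close> vanishes
  at their far end, which reduces their difference term to the Dirichlet term.\<close>

lemma dirichlet_form_eq_shift_defects:
  fixes \<phi> \<omega> :: "'g::ab_group_add \<Rightarrow> real"
  assumes W: "finite W" and supp: "\<forall>i. i \<notin> W \<longrightarrow> \<phi> i = 0" and \<omega>: "\<omega> summable_on UNIV"
    and e: "\<And>k l. e k l = (if k = l then 0 else 2 * \<omega> (k - l))"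
  shows "((\<lambda>j. \<omega> j * (shift_defect W \<phi> j)\<^sup>2) has_sum
    (\<Sum>k\<in>W. \<phi> k * ((\<Sum>l\<in>W. e k l * (\<phi> k - \<phi> l)) + (\<Sum>\<^sub>\<infinity>l\<in>-W. e k l) * \<phi> k))) UNIV"
proof -
  have row: "((\<lambda>j. (if j = 0 then 0 else 2 * \<omega> j) * (\<phi> k - \<phi> (k - j))) has_sum
      (\<Sum>l\<in>W. e k l * (\<phi> k - \<phi> l)) + (\<Sum>\<^sub>\<infinity>l\<in>-W. e k l) * \<phi> k) UNIV" for k
  proof -
    have "((\<lambda>j. 2 * \<omega> j - (if j = 0 then 2 * \<omega> 0 else 0)) has_sum 2 * infsum \<omega> UNIV - 2 * \<omega> 0) UNIV"
      by (intro has_sum_diff has_sum_cmult_right has_sum_infsum \<omega>)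
        (rule has_sum_finite_neutralI[of "{0}"], auto)
    then have "(\<lambda>j. if j = 0 then 0 else 2 * \<omega> j) summable_on UNIV"
      by (auto elim!: summable_on_cong[THEN iffD1, rotated] dest!: has_sum_imp_summable)
    then obtain s where "((\<lambda>j. if j = 0 then 0 else 2 * \<omega> j) has_sum s) UNIV"
      unfolding summable_on_def by blast
    then have "((\<lambda>l. e k l) has_sum s) UNIV"
      by (subst (asm) has_sum_reflect[of _ k, symmetric]) (simp add: e)
    then have "e k summable_on -W"
      by (intro summable_on_subset[OF has_sum_imp_summable]) auto
    then have "((\<lambda>l. e k l * \<phi> k) has_sum (\<Sum>\<^sub>\<infinity>l\<in>-W. e k l) * \<phi> k) (-W)"
      by (intro has_sum_cmult_left has_sum_infsum)
    then have "((\<lambda>l. e k l * (\<phi> k - \<phi> l)) has_sum (\<Sum>\<^sub>\<infinity>l\<in>-W. e k l) * \<phi> k) (-W)"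
      by (rule has_sum_cong[THEN iffD1, rotated]) (use supp in auto)
    moreover have "((\<lambda>l. e k l * (\<phi> k - \<phi> l)) has_sum (\<Sum>l\<in>W. e k l * (\<phi> k - \<phi> l))) W"
      using W by simp
    ultimately have "((\<lambda>l. e k l * (\<phi> k - \<phi> l)) has_sum
        (\<Sum>l\<in>W. e k l * (\<phi> k - \<phi> l)) + (\<Sum>\<^sub>\<infinity>l\<in>-W. e k l) * \<phi> k) (W \<union> - W)"
      by (intro has_sum_Un_disjoint) auto
    then have "((\<lambda>l. e k l * (\<phi> k - \<phi> l)) has_sum
        (\<Sum>l\<in>W. e k l * (\<phi> k - \<phi> l)) + (\<Sum>\<^sub>\<infinity>l\<in>-W. e k l) * \<phi> k) UNIV"
      by simp
    then have "((\<lambda>j. e k (k - j) * (\<phi> k - \<phi> (k - j))) has_sum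
        (\<Sum>l\<in>W. e k l * (\<phi> k - \<phi> l)) + (\<Sum>\<^sub>\<infinity>l\<in>-W. e k l) * \<phi> k) UNIV"
      by (subst has_sum_reflect[of "\<lambda>l. e k l * (\<phi> k - \<phi> l)" k])
    moreover have "e k (k - j) = (if j = 0 then 0 else 2 * \<omega> j)" for j
      by (auto simp: e)
    ultimately show ?thesis by simp
  qed
  have "((\<lambda>j. \<Sum>k\<in>W. \<phi> k * ((if j = 0 then 0 else 2 * \<omega> j) * (\<phi> k - \<phi> (k - j)))) has_sum
    (\<Sum>k\<in>W. \<phi> k * ((\<Sum>l\<in>W. e k l * (\<phi> k - \<phi> l)) + (\<Sum>\<^sub>\<infinity>l\<in>-W. e k l) * \<phi> k))) UNIV"
    by (intro has_sum_finite_sum has_sum_cmult_right row)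
  moreover have "(\<Sum>k\<in>W. \<phi> k * ((if j = 0 then 0 else 2 * \<omega> j) * (\<phi> k - \<phi> (k - j))))
      = \<omega> j * (shift_defect W \<phi> j)\<^sup>2" for j
  proof -
    have "\<omega> j * (shift_defect W \<phi> j)\<^sup>2 = 2 * \<omega> j * (\<Sum>k\<in>W. \<phi> k * (\<phi> k - \<phi> (k - j)))"
      unfolding shift_defect_nonneg(2)[OF W supp] sum_subtractf[symmetric]
      by (simp add: algebra_simps power2_eq_square)
    also have "\<dots> = (\<Sum>k\<in>W. \<phi> k * ((if j = 0 then 0 else 2 * \<omega> j) * (\<phi> k - \<phi> (k - j))))"
      unfolding sum_distrib_left by (intro sum.cong refl) simp
    finally show ?thesis by simp
  qed
  ultimately show ?thesis by simp
qed

lemma mean_norm_nonneg: "wiener_rep b A \<Longrightarrow> 0 \<le> mean_norm b j"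
  by (simp add: mean_norm_def sup_norm_nonneg wiener_rep_def)

lemma mean_norm_uminus [simp]: "mean_norm b (- j) = mean_norm b j"
  by (simp add: mean_norm_def)

text \<open>Since \<open>\<phi>\<close> is equally far from its translates by \<open>j\<close> and by \<open>- j\<close>, the commutator bound
  depends on the coefficients only through their means over \<open>j\<close> and \<open>- j\<close>. This makes the bounds
  for an operator and for its adjoint coincide, although the coefficient norms of the adjoint are
  reflected.\<close>

lemma has_sum_symmetrize:
  fixes \<beta> d :: "'g::ab_group_add \<Rightarrow> real"
  assumes s: "((\<lambda>j. \<beta> j * d j) has_sum s) UNIV" and d: "\<And>j. d (- j) = d j"
  shows "((\<lambda>j. \<beta> (- j) * d j) has_sum s) UNIV" "((\<lambda>j. (\<beta> j + \<beta> (- j)) / 2 * d j) has_sum s) UNIV"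
proof -
  show r: "((\<lambda>j. \<beta> (- j) * d j) has_sum s) UNIV"
    using s by (subst (asm) has_sum_reflect[of _ 0, symmetric]) (simp add: d)
  have "((\<lambda>j. (\<beta> j * d j + \<beta> (- j) * d j) * (1/2)) has_sum (s + s) * (1/2)) UNIV"
    by (intro has_sum_cmult_left has_sum_add s r)
  then show "((\<lambda>j. (\<beta> j + \<beta> (- j)) / 2 * d j) has_sum s) UNIV"
    by (simp add: algebra_simps add_divide_distrib)
qed

text \<open>The power \<open>p\<close> of a mean is at most the sum of the powers by monotonicity, which also covers
  \<open>p = 0\<close> with the convention \<open>0 powr 0 = 0\<close>; the power \<open>2 - p \<ge> 1\<close> of a bounded sequence is
  dominated by a multiple of the sequence itself.\<close>

lemma summable_mean_norm_powr:
  assumes p: "0 \<le> p" "p \<le> 1" and b: "wiener_rep b A"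
    and s: "(\<lambda>j. sup_norm (b j) powr p) summable_on UNIV"
  shows "(\<lambda>j. mean_norm b j powr p) summable_on UNIV"
    and "(\<lambda>j. mean_norm b j powr (2 - p)) summable_on UNIV"
proof -
  have refl: "(\<lambda>j. f (- j)) summable_on UNIV" if "f summable_on UNIV" for f :: "'a \<Rightarrow> real"
    using that has_sum_reflect[of f 0] unfolding summable_on_def by simp
  show "(\<lambda>j. mean_norm b j powr p) summable_on UNIV"
  proof (rule summable_on_comparison_test[OF summable_on_add[OF s refl[OF s]]])
    fix j
    show "mean_norm b j powr p \<le> sup_norm (b j) powr p + sup_norm (b (- j)) powr p"
    proof (cases "sup_norm (b j) \<le> sup_norm (b (- j))")
      case True
      then have "mean_norm b j powr p \<le> sup_norm (b (- j)) powr p"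
        using p mean_norm_nonneg[OF b, of j] by (intro powr_mono2) (auto simp: mean_norm_def)
      then show ?thesis by (simp add: add_increasing)
    next
      case False
      then have "mean_norm b j powr p \<le> sup_norm (b j) powr p"
        using p mean_norm_nonneg[OF b, of j] by (intro powr_mono2) (auto simp: mean_norm_def)
      then show ?thesis by (simp add: add_increasing2)
    qed
  qed auto
  have sb: "(\<lambda>j. sup_norm (b j)) summable_on UNIV" using b by (simp add: wiener_rep_def)
  have "(\<lambda>j. (sup_norm (b j) + sup_norm (b (- j))) * (1/2)) summable_on UNIV"
    by (intro summable_on_cmult_left summable_on_add sb refl)
  then have sm: "mean_norm b summable_on UNIV" by (simp add: mean_norm_def[abs_def])
  define K where "K = infsum (mean_norm b) UNIV"
  have K: "mean_norm b j \<le> K" for j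
    using finite_sum_le_infsum[OF sm, of "{j}"] mean_norm_nonneg[OF b] by (simp add: K_def)
  show "(\<lambda>j. mean_norm b j powr (2 - p)) summable_on UNIV"
  proof (rule summable_on_comparison_test[OF summable_on_cmult_left[OF sm, of "K powr (1 - p)"]])
    fix j
    have "mean_norm b j powr (2 - p) = mean_norm b j powr 1 * mean_norm b j powr (1 - p)"
      unfolding powr_add[symmetric] by simp
    also have "\<dots> \<le> mean_norm b j * K powr (1 - p)"
      using p K mean_norm_nonneg[OF b, of j] by (intro mult_mono powr_mono2) auto
    finally show "mean_norm b j powr (2 - p) \<le> mean_norm b j * K powr (1 - p)" .
  qed auto
qed

text \<open>The weight is a normalised eigenvector for the smallest eigenvalue of the Dirichlet Laplacian.
  With \<open>d j\<close> the distance between it and its translate by \<open>j\<close>, and \<open>m j\<close> the mean coefficient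
  norm, the commutator bound is \<open>\<Sum> m j * d j\<close>. Splitting
  \<open>m j = m j powr ((2 - p) / 2) * m j powr (p / 2)\<close> and applying the Cauchy-Schwarz inequality leaves
  the two factors of the truncation error: the second one is the square root of the Dirichlet form
  at an eigenvector of norm one, that is, of the eigenvalue.\<close>

lemma truncation_error_weight:
  fixes b :: "'g::ab_group_add \<Rightarrow> 'g \<Rightarrow> ('y::complex_normed_space, 'y) cblinfun"
  assumes p: "0 \<le> p" "p \<le> 1" and b: "wiener_rep b A"
    and s: "(\<lambda>j. sup_norm (b j) powr p) summable_on UNIV"
    and W: "finite W" "W \<noteq> {}"
  obtains \<phi> where "\<forall>i. i \<notin> W \<longrightarrow> \<phi> i = 0" "(\<Sum>i\<in>W. (\<phi> i)\<^sup>2) = 1"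
    "(\<Sum>\<^sub>\<infinity>j. sup_norm (b j) * shift_defect W \<phi> j) \<le> truncation_error p W b"
    "(\<Sum>\<^sub>\<infinity>j. sup_norm (b (- j)) * shift_defect W \<phi> j) \<le> truncation_error p W b"
proof -
  have sym: "edge_weight p b k l = edge_weight p b l k" for k l
    using mean_norm_uminus[of b "k - l"] by (simp add: edge_weight_def)
  obtain \<phi> where \<phi>: "\<forall>i. i \<notin> W \<longrightarrow> \<phi> i = 0" "(\<Sum>i\<in>W. (\<phi> i)\<^sup>2) = 1"
    and least: "(LEAST r. complex_of_real r \<in> spectrum_on (ell2_on W) (dirichlet_laplacian (edge_weight p b) W))
      = (\<Sum>k\<in>W. \<phi> k * ((\<Sum>l\<in>W. edge_weight p b k l * (\<phi> k - \<phi> l))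
          + (\<Sum>\<^sub>\<infinity>l\<in>-W. edge_weight p b k l) * \<phi> k))" (is "?m = ?Q")
    by (rule dirichlet_laplacian_min_eigenvector[of W "edge_weight p b", OF W sym])
  define d where "d j = shift_defect W \<phi> j" for j
  define \<omega> where "\<omega> j = mean_norm b j powr p" for j
  note sums = summable_mean_norm_powr[OF p b s]
  have "((\<lambda>j. \<omega> j * (d j)\<^sup>2) has_sum ?m) UNIV"
    unfolding least d_def
    by (rule dirichlet_form_eq_shift_defects[OF W(1) \<phi>(1)])
      (use sums in \<open>simp_all add: \<omega>_def[abs_def] edge_weight_def\<close>)
  \<comment> \<open>The index \<open>0\<close> can be left out of both series, as a translate by \<open>0\<close> changes nothing.\<close>
  moreover have d_zero: "d 0 = 0"
    by (simp add: d_def shift_defect_def power2_eq_square)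
  ultimately have form: "((\<lambda>j. \<omega> j * (d j)\<^sup>2) has_sum ?m) (-{0})"
    by (intro has_sum_drop_zero) simp_all
  have d0: "0 \<le> d j" for j unfolding d_def by (rule shift_defect_nonneg(1)[OF W(1) \<phi>(1)])
  have \<beta>0: "0 \<le> sup_norm (b j)" for j using b by (simp add: wiener_rep_def sup_norm_nonneg)
  have "(\<lambda>j. sup_norm (b j) * d j) summable_on UNIV"
  proof (rule summable_on_comparison_test)
    show "(\<lambda>j. sup_norm (b j) * 2) summable_on UNIV"
      using b by (intro summable_on_cmult_left) (simp add: wiener_rep_def)
    show "sup_norm (b j) * d j \<le> sup_norm (b j) * 2" for j
      using shift_defect_le[OF W(1) \<phi>(1), of j] \<phi>(2) \<beta>0 by (intro mult_left_mono) (auto simp: d_def)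
  qed (intro mult_nonneg_nonneg \<beta>0 d0)
  then obtain C where C: "((\<lambda>j. sup_norm (b j) * d j) has_sum C) UNIV"
    unfolding summable_on_def by blast
  have "d (- j) = d j" for j unfolding d_def by (rule shift_defect_uminus[OF W(1) \<phi>(1)])
  note C' = has_sum_symmetrize[OF C this]
  have "((\<lambda>j. mean_norm b j * d j) has_sum C) UNIV" using C'(2) by (simp add: mean_norm_def)
  then have "((\<lambda>j. mean_norm b j * d j) has_sum C) (-{0})"
    by (rule has_sum_drop_zero[where f = "\<lambda>j. mean_norm b j * d j"]) (simp add: d_zero)
  moreover have "mean_norm b j * d j
      = mean_norm b j powr ((2 - p) / 2) * (mean_norm b j powr (p / 2) * d j)" for j
  proof -
    have "mean_norm b j = mean_norm b j powr 1" using mean_norm_nonneg[OF b, of j] by simp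
    also have "\<dots> = mean_norm b j powr ((2 - p) / 2) * mean_norm b j powr (p / 2)"
      unfolding powr_add[symmetric] by (simp add: field_simps)
    finally show ?thesis by simp
  qed
  ultimately have C_fac: "((\<lambda>j. mean_norm b j powr ((2 - p) / 2) * (mean_norm b j powr (p / 2) * d j))
      has_sum C) (-{0})" by simp
  have sq1: "(mean_norm b j powr ((2 - p) / 2))\<^sup>2 = mean_norm b j powr (2 - p)" for j
    unfolding power2_eq_square powr_add[symmetric] by (simp only: field_sum_of_halves)
  have sq2: "(mean_norm b j powr (p / 2) * d j)\<^sup>2 = \<omega> j * (d j)\<^sup>2" for j
    unfolding power_mult_distrib \<omega>_def by (simp add: power2_eq_square powr_add[symmetric])
  have "C \<le> sqrt (\<Sum>\<^sub>\<infinity>j\<in>-{0}. mean_norm b j powr (2 - p)) * sqrt (\<Sum>\<^sub>\<infinity>j\<in>-{0}. \<omega> j * (d j)\<^sup>2)"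
    using infsum_cauchy_schwarz[of "\<lambda>j. mean_norm b j powr ((2 - p) / 2)" "-{0}"
        "\<lambda>j. mean_norm b j powr (p / 2) * d j"] summable_on_subset[OF sums(2)]
      has_sum_imp_summable[OF form] has_sum_imp_summable[OF C_fac] infsumI[OF C_fac]
    unfolding sq1 sq2 by simp
  also have "\<dots> = truncation_error p W b"
    unfolding truncation_error_def infsumI[OF form] ..
  finally have "C \<le> truncation_error p W b" .
  then show thesis
    using that[OF \<phi>] infsumI[OF C] infsumI[OF C'(1)] by (simp add: d_def)
qed

section \<open>A weighted shift for which the union of patch pseudospectra is empty\<close>

lemma norm_ell2_on_singleton:
  assumes "x \<in> ell2_on {k}"
  shows "norm x = norm (ell2_nth x k)"
proof -
  have "((\<lambda>i. (norm (ell2_nth x i))\<^sup>2) has_sum (norm (ell2_nth x k))\<^sup>2) UNIV"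
    by (rule has_sum_finite_neutralI[of "{k}"]) (use assms in \<open>auto simp: ell2_on_def\<close>)
  then have "(norm x)\<^sup>2 = (norm (ell2_nth x k))\<^sup>2"
    using ell2_has_sum_norm has_sum_unique by blast
  then show ?thesis by simp
qed

text \<open>For a weighted shift and a one-point window, every column of \<open>A - z\<close> has norm
  \<open>sqrt (cmod z ^ 2 + r ^ 2)\<close>, where \<open>r\<close> is one of the weights, and the same holds for the columns
  of the adjoint. If all weights exceed \<open>1\<close> but have infimum \<open>1\<close>, no column has norm at most \<open>1\<close>,
  whereas at \<open>z = 0\<close> the infimum of the column norms is \<open>1\<close>. The closed set therefore contains \<open>0\<close>
  and the union of the closed pseudospectra of the patches is empty, and so is its closure. Only one
  diagonal is nonzero, so the operator lies in every class.\<close>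

lemma closed_patches_neither_union_nor_closure:
  fixes p :: real
  obtains A :: "((int, complex) ell2, (int, complex) ell2) cblinfun" where
    "A \<in> wiener_class p" "0 \<in> gamma_closed 1 {0} A"
    "\<forall>k. patch_spec_closed 1 {0} A k = {}" "\<forall>k. patch_spec_closed 1 {0} (adj_op A) k = {}"
proof -
  define r where "r i = 1 + 1 / real_of_int (\<bar>i\<bar> + 1)" for i :: int
    \<comment> \<open>decreases to the unattained infimum \<open>1\<close> as \<open>\<bar>i\<bar>\<close> grows\<close>
  have r: "1 < r i" "r i \<le> 2" for i by (auto simp: r_def field_simps)
  define c where "c i = r i *\<^sub>R (cblinfun_id :: (complex, complex) cblinfun)" for i
  define b where "b j = (if j = 1 then c else (\<lambda>_. 0))" for j :: int
  define A where "A = mult_op c o\<^sub>C shift_op 1"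
  have "norm (c i) \<le> 2 * norm (cblinfun_id :: (complex, complex) cblinfun)" for i
    using r[of i] by (simp add: c_def mult_right_mono)
  then have bc: "bounded (range c)" unfolding bounded_iff by blast
  then have bb: "bounded (range (b j))" for j by (auto simp: b_def)
  have sup0: "sup_norm (b j) = 0" if "j \<noteq> 1" for j using that by (simp add: b_def sup_norm_def)
  have m0: "mult_op (b j) o\<^sub>C shift_op j = 0" if "j \<noteq> 1" for j
  proof -
    have "cblinfun_apply (mult_op (b j) o\<^sub>C shift_op j) x = cblinfun_apply 0 x" for x
      unfolding cblinfun_compose.rep_eq
      by (rule ell2_eqI, subst mult_op_nth[OF bb])
        (use that in \<open>simp add: b_def zero_cblinfun.rep_eq zero_ell2.rep_eq\<close>)
    then show ?thesis by (simp add: cblinfun_apply_inject[symmetric] fun_eq_iff)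
  qed
  have rep: "wiener_rep b A"
    unfolding wiener_rep_def
  proof (intro conjI allI bb)
    show "(\<lambda>j. sup_norm (b j)) summable_on UNIV"
      by (rule has_sum_imp_summable, rule has_sum_finite_neutralI[of "{1}"]) (auto simp: sup0)
    show "((\<lambda>j. mult_op (b j) o\<^sub>C shift_op j) has_sum A) UNIV"
      by (rule has_sum_finite_neutralI[of "{1}"]) (auto simp: m0, simp add: A_def b_def)
  qed
  have "(\<lambda>j. sup_norm (b j) powr p) summable_on UNIV"
    by (rule has_sum_imp_summable, rule has_sum_finite_neutralI[of "{1}"]) (auto simp: sup0)
  then have cls: "A \<in> wiener_class p" unfolding wiener_class_def using rep by blast
  have A_nth: "ell2_nth (cblinfun_apply A x) i = r i *\<^sub>R ell2_nth x (i - 1)" for x i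
    by (simp add: A_def cblinfun_compose.rep_eq mult_op_nth[OF bc] shift_op_nth c_def
        scaleR_cblinfun.rep_eq cblinfun_id.rep_eq)
  have adj_nth: "ell2_nth (cblinfun_apply (adj_op A) f) i = r (i + 1) *\<^sub>R ell2_nth f (i + 1)" for f i
  proof -
    have "cblinfun_apply (ell2_nth (cblinfun_apply (adj_op A) f) i) y
        = r (i + 1) *\<^sub>R cblinfun_apply (ell2_nth f (i + 1)) y" for y
      unfolding adj_op_nth A_nth
      by (rule infsumI, rule has_sum_finite_neutralI[of "{i + 1}"])
        (auto simp: ell2_single.rep_eq cblinfun_apply_scaleR)
    then show ?thesis
      by (simp add: cblinfun_apply_inject[symmetric] fun_eq_iff scaleR_cblinfun.rep_eq)
  qed
  have win: "window {0} k = {k}" for k :: int by (simp add: window_def)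
  \<comment> \<open>The shift moves a sequence at \<open>k\<close> off the diagonal, so the coordinate next to \<open>k\<close> of the image
    does not involve \<open>z\<close> and has norm a weight; the adjoint moves the sequence the other way.\<close>
  have low: "1 < patch_lower_norm {0} A z k" for z k
  proof -
    have "ereal (r (k + 1)) \<le> patch_lower_norm {0} A z k"
      unfolding patch_lower_norm_eq win lower_norm_def
    proof (rule INF_greatest)
      fix x :: "(int, complex) ell2" assume x: "x \<in> {x \<in> ell2_on {k}. norm x = 1}"
      have "ell2_nth (cblinfun_apply (A - z *\<^sub>C cblinfun_id) x) (k + 1) = r (k + 1) *\<^sub>R ell2_nth x k"
        using x by (simp add: cblinfun_apply_minus_apply minus_ell2.rep_eq scaleC_cblinfun_id_apply
            scaleC_ell2.rep_eq A_nth ell2_on_def)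
      then show "ereal (r (k + 1)) \<le> ereal (norm (cblinfun_apply (A - z *\<^sub>C cblinfun_id) x))"
        using norm_ell2_nth_le[of "cblinfun_apply (A - z *\<^sub>C cblinfun_id) x" "k + 1"]
          norm_ell2_on_singleton[of x k] x r(1)[of "k + 1"] by simp
    qed
    moreover have "1 < ereal (r (k + 1))" using r(1) by simp
    ultimately show ?thesis by (rule less_le_trans[rotated])
  qed
  have low': "1 < patch_lower_norm {0} (adj_op A) z k" for z k
  proof -
    have "ereal (r k) \<le> patch_lower_norm {0} (adj_op A) z k"
      unfolding patch_lower_norm_eq win lower_norm_def
    proof (rule INF_greatest)
      fix x :: "(int, complex dual) ell2" assume x: "x \<in> {x \<in> ell2_on {k}. norm x = 1}"
      have "ell2_nth (cblinfun_apply (adj_op A - z *\<^sub>C cblinfun_id) x) (k - 1) = r k *\<^sub>R ell2_nth x k"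
        using x by (simp add: cblinfun_apply_minus_apply minus_ell2.rep_eq scaleC_cblinfun_id_apply
            scaleC_ell2.rep_eq adj_nth ell2_on_def)
      then show "ereal (r k) \<le> ereal (norm (cblinfun_apply (adj_op A - z *\<^sub>C cblinfun_id) x))"
        using norm_ell2_nth_le[of "cblinfun_apply (adj_op A - z *\<^sub>C cblinfun_id) x" "k - 1"]
          norm_ell2_on_singleton[of x k] x r(1)[of k] by simp
    qed
    moreover have "1 < ereal (r k)" using r(1) by simp
    ultimately show ?thesis by (rule less_le_trans[rotated])
  qed
  have up: "patch_lower_norm {0} A 0 k \<le> ereal (r (k + 1))" for k
  proof -
    let ?x = "ell2_single k (1::complex)"
    have x: "?x \<in> ell2_on {k}" by (simp add: ell2_on_def ell2_single.rep_eq)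
    have "cblinfun_apply (A - 0 *\<^sub>C cblinfun_id) ?x \<in> ell2_on {k + 1}"
      by (auto simp: ell2_on_def cblinfun_apply_minus_apply minus_ell2.rep_eq scaleC_cblinfun_id_apply
          scaleC_ell2.rep_eq A_nth ell2_single.rep_eq scaleC_complex_def)
    from norm_ell2_on_singleton[OF this]
    have "norm (cblinfun_apply (A - 0 *\<^sub>C cblinfun_id) ?x) = r (k + 1)"
      using r(1)[of "k + 1"]
      by (simp add: cblinfun_apply_minus_apply minus_ell2.rep_eq scaleC_cblinfun_id_apply
          scaleC_ell2.rep_eq A_nth ell2_single.rep_eq scaleC_complex_def)
    then show ?thesis
      unfolding patch_lower_norm_eq win
      using lower_norm_le[OF x, of "A - 0 *\<^sub>C cblinfun_id"] norm_ell2_on_singleton[OF x]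
      by (simp add: ell2_single.rep_eq)
  qed
  have "(INF k. min (patch_lower_norm {0} A 0 k) (patch_lower_norm {0} (adj_op A) 0 k)) \<le> ereal 1"
    (is "?I \<le> _")
  proof (rule ccontr)
    assume "\<not> ?I \<le> ereal 1"
    then have "ereal 1 < ?I" by (simp only: not_le)
    from ereal_dense2[OF this] obtain t where "ereal 1 < ereal t" and t2: "ereal t < ?I" by blast
    then have t: "1 < t" by simp
    obtain n where n: "inverse (real (Suc n)) < t - 1" using reals_Archimedean[of "t - 1"] t by auto
    have "?I \<le> min (patch_lower_norm {0} A 0 (int n - 1)) (patch_lower_norm {0} (adj_op A) 0 (int n - 1))"
      by (rule INF_lower) simp
    also have "\<dots> \<le> ereal (r (int n))" using up[of "int n - 1"] by (simp add: min.coboundedI1)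
    also have "\<dots> < ereal t" using n by (simp add: r_def inverse_eq_divide add.commute)
    finally show False using t2 by simp
  qed
  then have "0 \<in> gamma_closed 1 {0} A" by (simp add: gamma_closed_def)
  moreover have "\<forall>k. patch_spec_closed 1 {0} A k = {}" "\<forall>k. patch_spec_closed 1 {0} (adj_op A) k = {}"
    using low low' unfolding patch_spec_closed_def one_ereal_def by (simp_all add: not_le)
  ultimately show thesis by (rule that[OF cls])
qed

section \<open>Pseudospectra and the pseudospectra of the patches\<close>

lemma lower_norm_nonneg: "0 \<le> lower_norm S B"
  unfolding lower_norm_def by (rule INF_greatest) simp

lemma lower_norm_antimono: "S \<subseteq> T \<Longrightarrow> lower_norm T B \<le> lower_norm S B"
  unfolding lower_norm_def by (rule INF_superset_mono) auto

lemma mu_le_patches: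
  "mu (A - z *\<^sub>C cblinfun_id)
    \<le> (INF k. min (patch_lower_norm W A z k) (patch_lower_norm W (adj_op A) z k))"
  unfolding mu_def adj_op_minus_scaleC_id patch_lower_norm_eq
  by (intro INF_greatest min.mono lower_norm_antimono subset_UNIV)

text \<open>One eigenvector serves both the operator and its adjoint, so the same error bounds both
  lower norms and passes to their minimum.\<close>

lemma patches_le_mu:
  fixes b :: "'g::ab_group_add \<Rightarrow> 'g \<Rightarrow> ('y::complex_normed_space, 'y) cblinfun"
  assumes "0 \<le> p" "p \<le> 1" and A: "A \<in> wiener_class p" and b: "wiener_rep b A"
    and W: "finite W" "W \<noteq> {}"
  shows "(INF k. min (patch_lower_norm W A z k) (patch_lower_norm W (adj_op A) z k))
    \<le> mu (A - z *\<^sub>C cblinfun_id) + ereal (truncation_error p W b)"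
proof -
  have s: "(\<lambda>j. sup_norm (b j) powr p) summable_on UNIV"
    using A wiener_rep_unique[OF b] by (auto simp: wiener_class_def)
  obtain \<phi> where \<phi>: "\<forall>i. i \<notin> W \<longrightarrow> \<phi> i = 0" "(\<Sum>i\<in>W. (\<phi> i)\<^sup>2) = 1"
    and E: "(\<Sum>\<^sub>\<infinity>j. sup_norm (b j) * shift_defect W \<phi> j) \<le> truncation_error p W b"
      "(\<Sum>\<^sub>\<infinity>j. sup_norm (b (- j)) * shift_defect W \<phi> j) \<le> truncation_error p W b"
    by (rule truncation_error_weight[OF assms(1,2) b s W])
  let ?G = "INF k. min (patch_lower_norm W A z k) (patch_lower_norm W (adj_op A) z k)"
  have \<beta>: "0 \<le> sup_norm (b j)" for j using b by (simp add: wiener_rep_def sup_norm_nonneg)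
  have \<beta>s: "(\<lambda>j. sup_norm (b j)) summable_on UNIV" using b by (simp add: wiener_rep_def)
  then have \<beta>s': "(\<lambda>j. sup_norm (b (- j))) summable_on UNIV"
    using has_sum_reflect[of "\<lambda>j. sup_norm (b j)" 0] unfolding summable_on_def by simp
  have "?G \<le> (INF k. patch_lower_norm W A z k)" by (rule INF_mono') simp
  also have "\<dots> \<le> lower_norm UNIV (A - z *\<^sub>C cblinfun_id)
      + ereal (\<Sum>\<^sub>\<infinity>j. sup_norm (b j) * shift_defect W \<phi> j)"
    unfolding patch_lower_norm_eq
    by (rule window_lower_norm_le[OF commutator_dominated_wiener[OF b] \<beta> \<beta>s W(1) \<phi>])
  also have "\<dots> \<le> lower_norm UNIV (A - z *\<^sub>C cblinfun_id) + ereal (truncation_error p W b)"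
    using E by (intro add_left_mono) simp
  finally have 1: "?G \<le> lower_norm UNIV (A - z *\<^sub>C cblinfun_id) + ereal (truncation_error p W b)" .
  have "?G \<le> (INF k. patch_lower_norm W (adj_op A) z k)" by (rule INF_mono') simp
  also have "\<dots> \<le> lower_norm UNIV (adj_op A - z *\<^sub>C cblinfun_id)
      + ereal (\<Sum>\<^sub>\<infinity>j. sup_norm (b (- j)) * shift_defect W \<phi> j)"
    unfolding patch_lower_norm_eq
    by (rule window_lower_norm_le[OF commutator_dominated_adj[OF b] \<beta> \<beta>s' W(1) \<phi>])
  also have "\<dots> \<le> lower_norm UNIV (adj_op A - z *\<^sub>C cblinfun_id) + ereal (truncation_error p W b)"
    using E by (intro add_left_mono) simp
  finally have 2: "?G \<le> lower_norm UNIV (adj_op A - z *\<^sub>C cblinfun_id) + ereal (truncation_error p W b)" .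
  show ?thesis
    unfolding mu_def adj_op_minus_scaleC_id
      min_def[of "lower_norm UNIV (A - z *\<^sub>C cblinfun_id)"] by (simp add: 1 2 split: if_split)
qed

theorem corollary5p10:
  fixes p :: real
    and W :: "'g::{ab_group_add, countable} set"
    and b :: "'g \<Rightarrow> 'g \<Rightarrow> ('y::chilbert_space, 'y) cblinfun"
    and A :: "(('g, 'y) ell2, ('g, 'y) ell2) cblinfun"
  assumes "0 \<le> p" and "p \<le> 1"
    and "A \<in> wiener_class p" and "wiener_rep b A"
    and "finite W" and "W \<noteq> {}"
  shows
    "((\<forall>\<epsilon>>0. gamma_open \<epsilon> W A \<subseteq> spec_open \<epsilon> A \<and>
             spec_open \<epsilon> A \<subseteq> gamma_open (\<epsilon> + truncation_error p W b) W A) \<and>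
      (\<forall>\<epsilon>\<ge>0. gamma_closed \<epsilon> W A \<subseteq> spec_closed \<epsilon> A \<and>
             spec_closed \<epsilon> A \<subseteq> gamma_closed (\<epsilon> + truncation_error p W b) W A)) \<and>
     ((\<exists>B::'y set. finite B \<and> cspan B = UNIV) \<longrightarrow>
      (\<forall>\<epsilon>>0. gamma_open \<epsilon> W A =
        (\<Union>k. patch_spec_open \<epsilon> W A k \<union> patch_spec_open \<epsilon> W (adj_op A) k))) \<and>
     (\<exists>(A' :: ((int, complex) ell2, (int, complex) ell2) cblinfun) W' \<epsilon>.
        A' \<in> wiener_class p \<and> finite W' \<and> W' \<noteq> {} \<and> 0 \<le> \<epsilon> \<and>
        gamma_closed \<epsilon> W' A' \<noteq>
          (\<Union>k. patch_spec_closed \<epsilon> W' A' k \<union> patch_spec_closed \<epsilon> W' (adj_op A') k) \<and>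
        gamma_closed \<epsilon> W' A' \<noteq>
          closure (\<Union>k. patch_spec_closed \<epsilon> W' A' k \<union> patch_spec_closed \<epsilon> W' (adj_op A') k))"
proof (intro conjI allI impI)
  fix \<epsilon> :: real
  note upper = patches_le_mu[OF assms] and lower = mu_le_patches[of A _ W]
  show "gamma_open \<epsilon> W A \<subseteq> spec_open \<epsilon> A"
    unfolding gamma_open_def spec_open_def using le_less_trans[OF lower] by auto
  show "gamma_closed \<epsilon> W A \<subseteq> spec_closed \<epsilon> A"
    unfolding gamma_closed_def spec_closed_def using order_trans[OF lower] by auto
  show "spec_closed \<epsilon> A \<subseteq> gamma_closed (\<epsilon> + truncation_error p W b) W A"
  proof
    fix z assume "z \<in> spec_closed \<epsilon> A"
    then have "mu (A - z *\<^sub>C cblinfun_id) + ereal (truncation_error p W b)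
        \<le> ereal \<epsilon> + ereal (truncation_error p W b)"
      unfolding spec_closed_def by (intro add_right_mono) simp
    then show "z \<in> gamma_closed (\<epsilon> + truncation_error p W b) W A"
      unfolding gamma_closed_def using order_trans[OF upper[of z]] by simp
  qed
  show "spec_open \<epsilon> A \<subseteq> gamma_open (\<epsilon> + truncation_error p W b) W A"
  proof
    fix z assume z: "z \<in> spec_open \<epsilon> A"
    have "0 \<le> mu (A - z *\<^sub>C cblinfun_id)" by (simp add: mu_def lower_norm_nonneg)
    then have "mu (A - z *\<^sub>C cblinfun_id) + ereal (truncation_error p W b)
        < ereal (\<epsilon> + truncation_error p W b)"
      using z unfolding spec_open_def by (cases "mu (A - z *\<^sub>C cblinfun_id)") auto
    then show "z \<in> gamma_open (\<epsilon> + truncation_error p W b) W A"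
      unfolding gamma_open_def using le_less_trans[OF upper[of z]] by simp
  qed
next
  fix \<epsilon> :: real
  show "gamma_open \<epsilon> W A = (\<Union>k. patch_spec_open \<epsilon> W A k \<union> patch_spec_open \<epsilon> W (adj_op A) k)"
    \<comment> \<open>An infimum is below \<open>\<epsilon>\<close> exactly when one of its terms is.\<close>
    by (auto simp: gamma_open_def patch_spec_open_def INF_less_iff min_less_iff_disj)
next
  obtain A' :: "((int, complex) ell2, (int, complex) ell2) cblinfun" where
    "A' \<in> wiener_class p" "0 \<in> gamma_closed 1 {0} A'"
    "\<forall>k. patch_spec_closed 1 {0} A' k = {}" "\<forall>k. patch_spec_closed 1 {0} (adj_op A') k = {}"
    by (rule closed_patches_neither_union_nor_closure[of p])
  then show "\<exists>(A' :: ((int, complex) ell2, (int, complex) ell2) cblinfun) W' \<epsilon>.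
        A' \<in> wiener_class p \<and> finite W' \<and> W' \<noteq> {} \<and> 0 \<le> \<epsilon> \<and>
        gamma_closed \<epsilon> W' A' \<noteq>
          (\<Union>k. patch_spec_closed \<epsilon> W' A' k \<union> patch_spec_closed \<epsilon> W' (adj_op A') k) \<and>
        gamma_closed \<epsilon> W' A' \<noteq>
          closure (\<Union>k. patch_spec_closed \<epsilon> W' A' k \<union> patch_spec_closed \<epsilon> W' (adj_op A') k)"
    by (intro exI[of _ A'] exI[of _ "{0}"] exI[of _ "1"]) auto
qed

end
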